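(* Let $\mathfrak g$ be a Lie algebra and let $\mathcal F$ be a $\mathfrak g$-Hopf algebra. Then, via the coaction of $\mathcal F$ on $U(\mathfrak g)$ extending the given coaction $\nabla_{\mathfrak g}:\mathfrak g\to\mathfrak g\otimes\mathcal F$ and the natural action of $U(\mathfrak g)$ on $\mathcal F$ extending the given action of $\mathfrak g$, the pair $(\mathcal F,U(\mathfrak g))$ is a matched pair of Hopf algebras. Conversely, if $\mathcal F$ is a commutative Hopf algebra and $(\mathcal F,U(\mathfrak g))$ is a matched pair of Hopf algebras, then $\mathcal F$ is a $\mathfrak g$-Hopf algebra (with respect to the restrictions to $\mathfrak g$ of the action of $U(\mathfrak g)$ on $\mathcal F$ and of the coaction of $\mathcal F$ on $U(\mathfrak g)$).
   Context: Everything is over $\mathbb C$; Lie algebras are finite dimensional; antipodes of Hopf algebras are invertible; Sweedler notation $\Delta(u)=u_{(1)}\otimes u_{(2)}$ is used for comultiplications and $\nabla(u)=u_{\langle 0\rangle}\otimes u_{\langle 1\rangle}$ for right coactions (summation suppressed). **$\mathfrak g$-Hopf algebras.** Let $\mathfrak g$ have basis $X_1,\dots,X_N$ and structure constants $[X_i,X_j]=\sum_k C^k_{ij}X_k$. Let $\mathcal F$ be a commutative Hopf algebra on which $\mathfrak g$ acts (from the left, $X\triangleright f$) by derivations. $\mathcal F$ is called a $\mathfrak g$-Hopf algebra if: (1) $\mathcal F$ coacts on $\mathfrak g$ from the right by $\nabla_{\mathfrak g}:\mathfrak g\to\mathfrak g\otimes\mathcal F$, $\nabla_{\mathfrak g}(X_j)=\sum_i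 X_i\otimes f^i_j$, and this coaction satisfies the structure identity of $\mathfrak g$: $$X_i\triangleright f^k_j-X_j\triangleright f^k_i=\sum_{s,r}C^k_{sr}f^r_if^s_j+\sum_l C^l_{ij}f^k_l\quad\text{for all } i,j,k;$$ (2) for all $X\in\mathfrak g$, $f\in\mathcal F$: $\Delta(X\triangleright f)=X\bullet\Delta(f)$ and $\varepsilon(X\triangleright f)=0$, where $X\bullet(f^1\otimes f^2)=X_{\langle0\rangle}\triangleright f^1\otimes X_{\langle1\rangle}f^2+f^1\otimes X\triangleright f^2$. **Extended coaction.** $\nabla_{\mathfrak g}$ is extended to $\nabla:U(\mathfrak g)\to U(\mathfrak g)\otimes\mathcal F$ inductively by $\nabla(1)=1\otimes1$ and $\nabla(uv)=u_{(1)\langle0\rangle}v_{\langle0\rangle}\otimes u_{(1)\langle1\rangle}(u_{(2)}\triangleright v_{\langle1\rangle})$ (this is well defined). **Matched pair of Hopf algebras.** A pair $(\mathcal F,\mathcal U)$ of Hopf algebras, with a left action $\triangleright$ of $\mathcal U$ on $\mathcal F$ and a right coaction $\nabla:\mathcal U\to\mathcal U\otimes\mathcal F$, is a matched pair if $\mathcal F$ is a left $\mathcal U$-module algebra ($u\triangleright(fg)=(u_{(1)}\triangleright f)(u_{(2)}\triangleright g)$, $u\triangleright1=\varepsilon(u)1$), $\mathcal U$ is a right $\mathcal F$-comodule coalgebra ($u_{\langle0\rangle(1)}\otimes u_{\langle0\rangle(2)}\otimes u_{\langle1\rangle}=u_{(1)\langle0\rangle}\otimes u_{(2)\langle0\rangle}\otimes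 u_{(1)\langle1\rangle}u_{(2)\langle1\rangle}$, $\varepsilon(u_{\langle0\rangle})u_{\langle1\rangle}=\varepsilon(u)1$), and for all $u,v\in\mathcal U$, $f\in\mathcal F$: $\varepsilon(u\triangleright f)=\varepsilon(u)\varepsilon(f)$; $\Delta(u\triangleright f)=u_{(1)\langle0\rangle}\triangleright f_{(1)}\otimes u_{(1)\langle1\rangle}(u_{(2)}\triangleright f_{(2)})$; $\nabla(1)=1\otimes1$; $\nabla(uv)=u_{(1)\langle0\rangle}v_{\langle0\rangle}\otimes u_{(1)\langle1\rangle}(u_{(2)}\triangleright v_{\langle1\rangle})$; $u_{(2)\langle0\rangle}\otimes(u_{(1)}\triangleright f)u_{(2)\langle1\rangle}=u_{(1)\langle0\rangle}\otimes u_{(1)\langle1\rangle}(u_{(2)}\triangleright f)$. *)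

theory Defs
  imports Complex_Main "HOL-Library.Poly_Mapping"
begin

section \<open>Complex vector spaces, algebras and Lie algebras\<close>

class scaleC =
  fixes scaleC :: "complex \<Rightarrow> 'a \<Rightarrow> 'a"  (infixr \<open>*\<^sub>C\<close> 75)

class complex_vector = scaleC + ab_group_add +
  assumes scaleC_add_right: "c *\<^sub>C (x + y) = c *\<^sub>C x + c *\<^sub>C y"
    and scaleC_add_left: "(c + d) *\<^sub>C x = c *\<^sub>C x + d *\<^sub>C x"
    and scaleC_scaleC: "c *\<^sub>C d *\<^sub>C x = (c * d) *\<^sub>C x"
    and scaleC_one: "1 *\<^sub>C x = x"

global_interpretation cvec: vector_space "scaleC :: complex \<Rightarrow> 'a \<Rightarrow> 'a :: complex_vector"
  by unfold_locales (simp_all add: scaleC_add_right scaleC_add_left scaleC_scaleC scaleC_one)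

global_interpretation cvec_pair: vector_space_pair
  "scaleC :: complex \<Rightarrow> 'a \<Rightarrow> 'a :: complex_vector"
  "scaleC :: complex \<Rightarrow> 'b \<Rightarrow> 'b :: complex_vector"
  by unfold_locales

text \<open>Unital associative algebras. Since \<^class>\<open>ring_1\<close> requires \<open>0 \<noteq> 1\<close>, only the zero
  algebra is excluded; it is not a Hopf algebra, because \<open>\<epsilon>(1) = 1\<close>.\<close>

class complex_algebra_1 = complex_vector + ring_1 +
  assumes mult_scaleC_left: "(c *\<^sub>C x) * y = c *\<^sub>C (x * y)"
    and mult_scaleC_right: "x * (c *\<^sub>C y) = c *\<^sub>C (x * y)"

class lie_algebra = complex_vector +
  fixes bracket :: "'a \<Rightarrow> 'a \<Rightarrow> 'a"
  assumes bracket_add_left: "bracket (x + y) z = bracket x z + bracket y z"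
    and bracket_add_right: "bracket x (y + z) = bracket x y + bracket x z"
    and bracket_scaleC_left: "bracket (c *\<^sub>C x) y = c *\<^sub>C bracket x y"
    and bracket_scaleC_right: "bracket x (c *\<^sub>C y) = c *\<^sub>C bracket x y"
    and bracket_self: "bracket x x = 0"
    and jacobi: "bracket x (bracket y z) + bracket y (bracket z x) + bracket z (bracket x y) = 0"

abbreviation clinear :: "('a::complex_vector \<Rightarrow> 'b::complex_vector) \<Rightarrow> bool" where
  "clinear \<equiv> Vector_Spaces.linear scaleC scaleC"

definition cbilinear :: "('a::complex_vector \<Rightarrow> 'b::complex_vector \<Rightarrow> 'c::complex_vector) \<Rightarrow> bool" where
  "cbilinear B \<longleftrightarrow> (\<forall>x. clinear (B x)) \<and> (\<forall>y. clinear (\<lambda>x. B x y))"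

lemma clinear_iff: "clinear f \<longleftrightarrow> (\<forall>x y. f (x + y) = f x + f y) \<and> (\<forall>c x. f (c *\<^sub>C x) = c *\<^sub>C f x)"
  by (simp add: Vector_Spaces.linear_iff cvec.vector_space_axioms)

lemma clinearI:
  assumes "\<And>x y. f (x + y) = f x + f y" "\<And>c x. f (c *\<^sub>C x) = c *\<^sub>C f x"
  shows "clinear f"
  using assms by (simp add: clinear_iff)

lemma clinearD:
  assumes "clinear f"
  shows "f (x + y) = f x + f y" "f (c *\<^sub>C x) = c *\<^sub>C f x" "f 0 = 0" "f (- x) = - f x" "f (x - y) = f x - f y"
  using assms cvec_pair.linear_add cvec_pair.linear_scale cvec_pair.linear_0
    cvec_pair.linear_neg cvec_pair.linear_diff by blast+

lemma cbilinearI: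
  assumes "\<And>x x' y. B (x + x') y = B x y + B x' y" "\<And>c x y. B (c *\<^sub>C x) y = c *\<^sub>C B x y"
    "\<And>x y y'. B x (y + y') = B x y + B x y'" "\<And>c x y. B x (c *\<^sub>C y) = c *\<^sub>C B x y"
  shows "cbilinear B"
  using assms by (simp add: cbilinear_def clinear_iff)

lemma cbilinearD:
  assumes "cbilinear B"
  shows "B (x + x') y = B x y + B x' y" "B (c *\<^sub>C x) y = c *\<^sub>C B x y"
    "B x (y + y') = B x y + B x y'" "B x (c *\<^sub>C y) = c *\<^sub>C B x y"
  using assms by (simp_all add: cbilinear_def clinear_iff)

lemma clinear_functional_exists:
  fixes x :: "'a::complex_vector"
  assumes "x \<noteq> 0"
  obtains \<phi> :: "'a \<Rightarrow> complex" where "\<And>x y. \<phi> (x + y) = \<phi> x + \<phi> y" "\<And>c x. \<phi> (c *\<^sub>C x) = c * \<phi> x" "\<phi> x = 1"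
proof -
  interpret p: vector_space_pair "scaleC :: complex \<Rightarrow> 'a \<Rightarrow> 'a" "(*) :: complex \<Rightarrow> complex \<Rightarrow> complex"
    by unfold_locales (simp_all add: algebra_simps)
  have "\<not> cvec.dependent {x}" using assms by simp
  then obtain g where g: "Vector_Spaces.linear scaleC (*) g" "\<forall>y\<in>{x}. g y = 1"
    using p.linear_independent_extend[of "{x}" "\<lambda>_. 1"] by auto
  then show thesis
    using that[of g] by (simp add: Vector_Spaces.linear_iff)
qed

instantiation complex :: complex_algebra_1
begin

definition scaleC_complex :: "complex \<Rightarrow> complex \<Rightarrow> complex" where
  "scaleC_complex c x = c * x"

instance by standard (simp_all add: scaleC_complex_def algebra_simps)

end

instantiation poly_mapping :: (type, complex_vector) complex_vector
begin

definition scaleC_poly_mapping :: "complex \<Rightarrow> ('a \<Rightarrow>\<^sub>0 'b) \<Rightarrow> ('a \<Rightarrow>\<^sub>0 'b)" where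
  "scaleC_poly_mapping c p = Poly_Mapping.map (scaleC c) p"

lemma lookup_scaleC: "Poly_Mapping.lookup (c *\<^sub>C p) k = c *\<^sub>C Poly_Mapping.lookup p k"
  by (simp add: scaleC_poly_mapping_def Poly_Mapping.map.rep_eq when_def)

instance
  by standard
    (auto intro!: poly_mapping_eqI simp: lookup_scaleC lookup_add scaleC_add_right scaleC_add_left
      scaleC_scaleC scaleC_one)

end

text \<open>The linear extension of \<open>h\<close> to the free vector space \<open>'k \<Rightarrow>\<^sub>0 complex\<close>.\<close>

definition lin_ext :: "('k \<Rightarrow> 'a::complex_vector) \<Rightarrow> ('k \<Rightarrow>\<^sub>0 complex) \<Rightarrow> 'a" where
  "lin_ext h p = (\<Sum>k\<in>Poly_Mapping.keys p. Poly_Mapping.lookup p k *\<^sub>C h k)"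

lemma lin_ext_superset:
  assumes "finite A" "Poly_Mapping.keys p \<subseteq> A"
  shows "lin_ext h p = (\<Sum>k\<in>A. Poly_Mapping.lookup p k *\<^sub>C h k)"
  unfolding lin_ext_def
  by (rule sum.mono_neutral_left) (use assms in \<open>auto simp: in_keys_iff\<close>)

lemma clinear_lin_ext: "clinear (lin_ext h)"
proof (rule clinearI)
  fix p q :: "'a \<Rightarrow>\<^sub>0 complex" and c
  let ?A = "Poly_Mapping.keys p \<union> Poly_Mapping.keys q"
  show "lin_ext h (p + q) = lin_ext h p + lin_ext h q"
    using keys_add[of p q]
    by (simp add: lin_ext_superset[of ?A] lookup_add scaleC_add_left sum.distrib)
  have "Poly_Mapping.keys (c *\<^sub>C p) \<subseteq> Poly_Mapping.keys p"
    by (auto simp: in_keys_iff lookup_scaleC)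
  then show "lin_ext h (c *\<^sub>C p) = c *\<^sub>C lin_ext h p"
    by (simp add: lin_ext_superset[of "Poly_Mapping.keys p"] lookup_scaleC scaleC_complex_def
        cvec.scale_sum_right scaleC_scaleC)
qed

lemma lin_ext_single [simp]: "lin_ext h (Poly_Mapping.single k c) = c *\<^sub>C h k"
  by (cases "c = 0") (simp_all add: lin_ext_def)

lemma scaleC_single: "c *\<^sub>C Poly_Mapping.single k (d::complex) = Poly_Mapping.single k (c * d)"
  by (rule poly_mapping_eqI) (simp add: lookup_scaleC lookup_single scaleC_complex_def when_def)

lemma lin_ext_singles: "lin_ext (\<lambda>k. Poly_Mapping.single k 1) p = p"
  unfolding lin_ext_def
  by (rule poly_mapping_eqI)
    (simp add: lookup_sum scaleC_single lookup_single when_def in_keys_iff)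

lemma clinear_sum: "clinear f \<Longrightarrow> f (sum g A) = (\<Sum>a\<in>A. f (g a))"
  by (rule cvec_pair.linear_sum)

lemma clinear_eq_lin_ext:
  assumes "clinear f"
  shows "f p = lin_ext (\<lambda>k. f (Poly_Mapping.single k 1)) p"
proof -
  have "f p = f (lin_ext (\<lambda>k. Poly_Mapping.single k 1) p)"
    by (simp add: lin_ext_singles)
  also have "\<dots> = lin_ext (\<lambda>k. f (Poly_Mapping.single k 1)) p"
    unfolding lin_ext_def by (simp add: clinear_sum[OF assms] clinearD(2)[OF assms])
  finally show ?thesis .
qed

lemma clinear_eqI:
  assumes "clinear f" "clinear g" "\<And>k. f (Poly_Mapping.single k 1) = g (Poly_Mapping.single k (1::complex))"
  shows "f p = g p"
  unfolding clinear_eq_lin_ext[OF assms(1), of p] clinear_eq_lin_ext[OF assms(2), of p]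
  by (simp only: assms(3))

lemma clinear_vanishes_on_span:
  assumes "clinear f" "\<And>r. r \<in> R \<Longrightarrow> f r = 0" "p \<in> cvec.span R"
  shows "f p = 0"
  using assms(3)
proof (induction rule: cvec.span_induct)
  case base
  then show ?case
    by (auto intro!: cvec.subspaceI simp: clinearD[OF assms(1)])
next
  case (step x)
  then show ?case by (rule assms(2))
qed


section \<open>Tensor products\<close>

definition tensor_relators :: "('a::complex_vector \<times> 'b::complex_vector \<Rightarrow>\<^sub>0 complex) set" where
  "tensor_relators =
     {Poly_Mapping.single (x + x', y) 1 - Poly_Mapping.single (x, y) 1 - Poly_Mapping.single (x', y) 1 | x x' y. True}
   \<union> {Poly_Mapping.single (x, y + y') 1 - Poly_Mapping.single (x, y) 1 - Poly_Mapping.single (x, y') 1 | x y y'. True}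
   \<union> {Poly_Mapping.single (c *\<^sub>C x, y) 1 - c *\<^sub>C Poly_Mapping.single (x, y) 1 | c x y. True}
   \<union> {Poly_Mapping.single (x, c *\<^sub>C y) 1 - c *\<^sub>C Poly_Mapping.single (x, y) 1 | c x y. True}"

definition tensor_rel ::
    "('a::complex_vector \<times> 'b::complex_vector \<Rightarrow>\<^sub>0 complex) \<Rightarrow> ('a \<times> 'b \<Rightarrow>\<^sub>0 complex) \<Rightarrow> bool" where
  "tensor_rel p q \<longleftrightarrow> p - q \<in> cvec.span tensor_relators"

lemma equivp_diff_span: "equivp (\<lambda>p q. p - q \<in> cvec.span R)"
proof (rule equivpI)
  show "reflp (\<lambda>p q. p - q \<in> cvec.span R)"
    by (simp add: reflp_def cvec.span_zero)
  show "symp (\<lambda>p q. p - q \<in> cvec.span R)"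
    unfolding symp_def by (auto dest: cvec.span_neg)
  show "transp (\<lambda>p q. p - q \<in> cvec.span R)"
    unfolding transp_def by (auto dest: cvec.span_add)
qed

lemma diff_span_closed:
  assumes "p - p' \<in> cvec.span R"
  shows "q - q' \<in> cvec.span R \<Longrightarrow> (p + q) - (p' + q') \<in> cvec.span R"
    and "q - q' \<in> cvec.span R \<Longrightarrow> (p - q) - (p' - q') \<in> cvec.span R"
    and "- p - - p' \<in> cvec.span R"
    and "c *\<^sub>C p - c *\<^sub>C p' \<in> cvec.span R"
proof -
  show "(p + q) - (p' + q') \<in> cvec.span R" if "q - q' \<in> cvec.span R"
    using cvec.span_add[OF assms that] by (simp add: algebra_simps)
  show "(p - q) - (p' - q') \<in> cvec.span R" if "q - q' \<in> cvec.span R"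
    using cvec.span_diff[OF assms that] by (simp add: algebra_simps)
  show "- p - - p' \<in> cvec.span R"
    using cvec.span_neg[OF assms] by simp
  show "c *\<^sub>C p - c *\<^sub>C p' \<in> cvec.span R"
    using cvec.span_scale[OF assms] by (simp add: cvec.scale_right_diff_distrib)
qed

lemma equivp_tensor_rel: "equivp tensor_rel"
  using equivp_diff_span unfolding tensor_rel_def[abs_def] .

quotient_type (overloaded) ('a, 'b) tensor = "'a::complex_vector \<times> 'b::complex_vector \<Rightarrow>\<^sub>0 complex" / tensor_rel
  by (rule equivp_tensor_rel)

type_notation tensor (infixr \<open>\<otimes>\<close> 21)

instantiation tensor :: (complex_vector, complex_vector) complex_vector
begin

lift_definition zero_tensor :: "'a \<otimes> 'b" is 0 .

lift_definition plus_tensor :: "'a \<otimes> 'b \<Rightarrow> 'a \<otimes> 'b \<Rightarrow> 'a \<otimes> 'b" is "(+)"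
  unfolding tensor_rel_def by (rule diff_span_closed)

lift_definition uminus_tensor :: "'a \<otimes> 'b \<Rightarrow> 'a \<otimes> 'b" is uminus
  unfolding tensor_rel_def by (rule diff_span_closed)

lift_definition minus_tensor :: "'a \<otimes> 'b \<Rightarrow> 'a \<otimes> 'b \<Rightarrow> 'a \<otimes> 'b" is "(-)"
  unfolding tensor_rel_def by (rule diff_span_closed)

lift_definition scaleC_tensor :: "complex \<Rightarrow> 'a \<otimes> 'b \<Rightarrow> 'a \<otimes> 'b" is scaleC
  unfolding tensor_rel_def by (rule diff_span_closed)

instance
  by standard
    (transfer, simp add: equivp_reflp[OF equivp_tensor_rel] algebra_simps scaleC_add_right
      scaleC_add_left scaleC_scaleC scaleC_one)+

end

lift_definition pure_tensor :: "'a::complex_vector \<Rightarrow> 'b::complex_vector \<Rightarrow> 'a \<otimes> 'b"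
    (infixr \<open>\<otimes>\<close> 68)
  is "\<lambda>x y. Poly_Mapping.single (x, y) 1" .

text \<open>\<open>sweedler t (\<lambda>x y. B x y)\<close> is the sum of \<open>B x y\<close> over the pure tensors \<open>x \<otimes> y\<close> of a
  representation of \<open>t\<close>, i.e. the value at \<open>t\<close> of the linear map induced by \<open>B\<close>. It is
  independent of the representation only for bilinear \<open>B\<close>; for those
  \<open>clinear_sweedler\<close> and \<open>sweedler_pure\<close> below give the universal property.\<close>

definition sweedler :: "'a::complex_vector \<otimes> 'b::complex_vector \<Rightarrow> ('a \<Rightarrow> 'b \<Rightarrow> 'c::complex_vector) \<Rightarrow> 'c" where
  "sweedler t B = lin_ext (\<lambda>(x, y). B x y) (rep_tensor t)"

lemma lin_ext_tensor_rel:
  assumes "cbilinear B" "tensor_rel p q"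
  shows "lin_ext (\<lambda>(x, y). B x y) p = lin_ext (\<lambda>(x, y). B x y) q"
proof -
  let ?L = "lin_ext (\<lambda>(x, y). B x y)"
  have "?L (p - q) = 0"
    using assms(2) unfolding tensor_rel_def
    by (rule clinear_vanishes_on_span[OF clinear_lin_ext, rotated])
      (auto simp: tensor_relators_def clinearD[OF clinear_lin_ext] cbilinearD[OF assms(1)] scaleC_one)
  then show ?thesis
    by (simp add: clinearD[OF clinear_lin_ext])
qed

lemma sweedler_abs:
  assumes "cbilinear B"
  shows "sweedler (abs_tensor p) B = lin_ext (\<lambda>(x, y). B x y) p"
  unfolding sweedler_def
  by (rule lin_ext_tensor_rel[OF assms])
    (rule Quotient3_rep_abs[OF Quotient3_tensor equivp_reflp[OF equivp_tensor_rel]])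

lemma clinear_abs_tensor: "clinear abs_tensor"
  by (rule clinearI) (simp_all add: plus_tensor.abs_eq scaleC_tensor.abs_eq)

lemma abs_tensor_surj: obtains p where "t = abs_tensor p"
  using Quotient3_abs_rep[OF Quotient3_tensor] by metis

lemma clinear_sweedler:
  assumes "cbilinear B"
  shows "clinear (\<lambda>t. sweedler t B)"
proof (rule clinearI)
  fix s t :: "'a \<otimes> 'b" and c
  obtain p q where [simp]: "s = abs_tensor p" "t = abs_tensor q"
    by (meson abs_tensor_surj)
  show "sweedler (s + t) B = sweedler s B + sweedler t B"
    by (simp add: plus_tensor.abs_eq sweedler_abs[OF assms] clinearD[OF clinear_lin_ext])
  show "sweedler (c *\<^sub>C s) B = c *\<^sub>C sweedler s B"
    by (simp add: scaleC_tensor.abs_eq sweedler_abs[OF assms] clinearD[OF clinear_lin_ext])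
qed

lemma sweedler_pure:
  assumes "cbilinear B"
  shows "sweedler (x \<otimes> y) B = B x y"
  by (simp add: pure_tensor.abs_eq sweedler_abs[OF assms] scaleC_one)

lemma tensor_ext:
  assumes "clinear f" "clinear g" "\<And>x y. f (x \<otimes> y) = g (x \<otimes> y)"
  shows "f t = g t"
proof -
  obtain p where p: "t = abs_tensor p" by (rule abs_tensor_surj)
  have "(f \<circ> abs_tensor) p = (g \<circ> abs_tensor) p"
  proof (rule clinear_eqI)
    show "clinear (f \<circ> abs_tensor)" "clinear (g \<circ> abs_tensor)"
      by (auto intro!: clinearI simp: clinearD[OF assms(1)] clinearD[OF assms(2)] clinearD[OF clinear_abs_tensor])
    show "(f \<circ> abs_tensor) (Poly_Mapping.single k 1) = (g \<circ> abs_tensor) (Poly_Mapping.single k 1)" for k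
      using assms(3)[of "fst k" "snd k"] by (simp add: pure_tensor.abs_eq)
  qed
  then show ?thesis by (simp add: p)
qed

lemma cbilinear_pure: "cbilinear (\<otimes>)"
proof (rule cbilinearI; transfer)
  fix x x' :: 'a and y y' :: 'b and c
  have R: "r \<in> tensor_relators \<Longrightarrow> r \<in> cvec.span tensor_relators" for r :: "'a \<times> 'b \<Rightarrow>\<^sub>0 complex"
    by (rule cvec.span_base)
  let ?s = "\<lambda>x y. Poly_Mapping.single (x, y) (1::complex) :: 'a \<times> 'b \<Rightarrow>\<^sub>0 complex"
  show "tensor_rel (?s (x + x') y) (?s x y + ?s x' y)" "tensor_rel (?s x (y + y')) (?s x y + ?s x y')"
    "tensor_rel (?s (c *\<^sub>C x) y) (c *\<^sub>C ?s x y)" "tensor_rel (?s x (c *\<^sub>C y)) (c *\<^sub>C ?s x y)"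
    unfolding tensor_rel_def diff_diff_eq[symmetric]
    by (rule R, (simp only: tensor_relators_def Un_iff mem_Collect_eq; blast))+
qed

lemmas pure_tensor_linear = cbilinearD[OF cbilinear_pure]

lemma sweedler_cong_linear:
  assumes "clinear (f :: 'c::complex_vector \<Rightarrow> 'd::complex_vector)" "cbilinear B"
  shows "f (sweedler t B) = sweedler t (\<lambda>x y. f (B x y))"
proof (rule tensor_ext[of "\<lambda>t. f (sweedler t B)"])
  have B: "cbilinear (\<lambda>x y. f (B x y))"
    by (rule cbilinearI) (simp_all add: clinearD[OF assms(1)] cbilinearD[OF assms(2)])
  show "clinear (\<lambda>t. f (sweedler t B))"
    by (rule clinearI) (simp_all add: clinearD[OF assms(1)] clinearD[OF clinear_sweedler[OF assms(2)]])
  show "clinear (\<lambda>t. sweedler t (\<lambda>x y. f (B x y)))"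
    by (rule clinear_sweedler[OF B])
  show "f (sweedler (x \<otimes> y) B) = sweedler (x \<otimes> y) (\<lambda>x y. f (B x y))" for x y
    by (simp add: sweedler_pure[OF assms(2)] sweedler_pure[OF B])
qed

lemma sweedler_pure_id: "sweedler t (\<otimes>) = t"
proof (rule tensor_ext[of "\<lambda>t. sweedler t (\<otimes>)" "\<lambda>t. t"])
  show "clinear (\<lambda>t::'a \<otimes> 'b. sweedler t (\<otimes>))"
    by (rule clinear_sweedler[OF cbilinear_pure])
  show "clinear (\<lambda>t::'a \<otimes> 'b. t)" by (rule clinearI) simp_all
  show "sweedler (x \<otimes> y) (\<otimes>) = x \<otimes> y" for x :: 'a and y :: 'b
    by (rule sweedler_pure[OF cbilinear_pure])
qed


subsection \<open>The tensor product of algebras\<close>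

definition tensor_mult ::
    "'a::complex_algebra_1 \<otimes> 'b::complex_algebra_1 \<Rightarrow> 'a \<otimes> 'b \<Rightarrow> 'a \<otimes> 'b" where
  "tensor_mult s t = sweedler s (\<lambda>a b. sweedler t (\<lambda>c d. (a * c) \<otimes> (b * d)))"

lemma cbilinear_tensor_mult_inner:
  "cbilinear (\<lambda>c d. ((a::'a::complex_algebra_1) * c) \<otimes> ((b::'b::complex_algebra_1) * d))"
  by (rule cbilinearI) (simp_all add: distrib_left mult_scaleC_right pure_tensor_linear)

lemma cbilinear_tensor_mult_outer:
  "cbilinear (\<lambda>a b. sweedler t (\<lambda>c d. ((a::'a::complex_algebra_1) * c) \<otimes> ((b::'b::complex_algebra_1) * d)))"
proof -
  define F where "F a b t = sweedler t (\<lambda>c d. ((a::'a) * c) \<otimes> ((b::'b) * d))" for a b t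
  have L: "clinear (\<lambda>t. F a b t)" for a b
    unfolding F_def by (rule clinear_sweedler[OF cbilinear_tensor_mult_inner])
  have P: "F a b (x \<otimes> y) = (a * x) \<otimes> (b * y)" for a b x y
    unfolding F_def by (rule sweedler_pure[OF cbilinear_tensor_mult_inner])
  note LD = clinearD[OF L]
  show ?thesis
    unfolding F_def[symmetric]
  proof (rule cbilinearI)
    fix a a' b b' c
    show "F (a + a') b t = F a b t + F a' b t"
      by (rule tensor_ext[of "F (a + a') b" "\<lambda>t. F a b t + F a' b t"])
        (simp_all add: clinear_iff LD P distrib_right pure_tensor_linear scaleC_add_right)
    show "F a (b + b') t = F a b t + F a b' t"
      by (rule tensor_ext[of "F a (b + b')" "\<lambda>t. F a b t + F a b' t"])
        (simp_all add: clinear_iff LD P distrib_right pure_tensor_linear scaleC_add_right)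
    show "F (c *\<^sub>C a) b t = c *\<^sub>C F a b t"
      by (rule tensor_ext[of "F (c *\<^sub>C a) b" "\<lambda>t. c *\<^sub>C F a b t"])
        (simp_all add: clinear_iff LD P mult_scaleC_left pure_tensor_linear scaleC_add_right
          scaleC_scaleC mult.commute)
    show "F a (c *\<^sub>C b) t = c *\<^sub>C F a b t"
      by (rule tensor_ext[of "F a (c *\<^sub>C b)" "\<lambda>t. c *\<^sub>C F a b t"])
        (simp_all add: clinear_iff LD P mult_scaleC_left pure_tensor_linear scaleC_add_right
          scaleC_scaleC mult.commute)
  qed
qed

lemma tensor_mult_pure: "tensor_mult (a \<otimes> b) (c \<otimes> d) = (a * c) \<otimes> (b * d)"
  unfolding tensor_mult_def
  by (rule trans[OF sweedler_pure[OF cbilinear_tensor_mult_outer] sweedler_pure[OF cbilinear_tensor_mult_inner]])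

lemma cbilinear_tensor_mult: "cbilinear tensor_mult"
  unfolding cbilinear_def
proof (intro conjI allI)
  show L: "clinear (\<lambda>s. tensor_mult s t)" for t :: "'a \<otimes> 'b"
    unfolding tensor_mult_def by (rule clinear_sweedler[OF cbilinear_tensor_mult_outer])
  have P: "tensor_mult (a \<otimes> b) t = sweedler t (\<lambda>c d. (a * c) \<otimes> (b * d))" for a b and t :: "'a \<otimes> 'b"
    unfolding tensor_mult_def by (rule sweedler_pure[OF cbilinear_tensor_mult_outer])
  note LD = clinearD[OF L] and PD = clinearD[OF clinear_sweedler[OF cbilinear_tensor_mult_inner]]
  show "clinear (tensor_mult s)" for s :: "'a \<otimes> 'b"
  proof (rule clinearI)
    fix t t' :: "'a \<otimes> 'b" and c
    show "tensor_mult s (t + t') = tensor_mult s t + tensor_mult s t'"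
      by (rule tensor_ext[of "\<lambda>s. tensor_mult s (t + t')" "\<lambda>s. tensor_mult s t + tensor_mult s t'"])
        (simp_all add: clinear_iff LD P PD scaleC_add_right)
    show "tensor_mult s (c *\<^sub>C t) = c *\<^sub>C tensor_mult s t"
      by (rule tensor_ext[of "\<lambda>s. tensor_mult s (c *\<^sub>C t)" "\<lambda>s. c *\<^sub>C tensor_mult s t"])
        (simp_all add: clinear_iff LD P PD scaleC_add_right scaleC_scaleC mult.commute)
  qed
qed

lemma pure_tensor_nonzero:
  fixes x :: "'a::complex_vector" and y :: "'b::complex_vector"
  assumes "x \<noteq> 0" "y \<noteq> 0"
  shows "x \<otimes> y \<noteq> 0"
proof
  assume 0: "x \<otimes> y = 0"
  obtain \<phi> :: "'a \<Rightarrow> complex" where \<phi>: "\<And>x y. \<phi> (x + y) = \<phi> x + \<phi> y" "\<And>c x. \<phi> (c *\<^sub>C x) = c * \<phi> x" "\<phi> x = 1"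
    using clinear_functional_exists[OF assms(1)] by blast
  obtain \<psi> :: "'b \<Rightarrow> complex" where \<psi>: "\<And>x y. \<psi> (x + y) = \<psi> x + \<psi> y" "\<And>c x. \<psi> (c *\<^sub>C x) = c * \<psi> x" "\<psi> y = 1"
    using clinear_functional_exists[OF assms(2)] by blast
  have B: "cbilinear (\<lambda>x y. \<phi> x * \<psi> y)"
    by (rule cbilinearI) (simp_all add: \<phi> \<psi> scaleC_complex_def algebra_simps)
  have "sweedler (x \<otimes> y) (\<lambda>x y. \<phi> x * \<psi> y) = 1"
    by (simp add: sweedler_pure[OF B] \<phi> \<psi>)
  moreover have "sweedler (0 :: 'a \<otimes> 'b) (\<lambda>x y. \<phi> x * \<psi> y) = 0"
    by (rule clinearD(3)[OF clinear_sweedler[OF B]])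
  ultimately show False by (simp add: 0)
qed

instantiation tensor :: (complex_algebra_1, complex_algebra_1) complex_algebra_1
begin

definition one_tensor :: "'a \<otimes> 'b" where "one_tensor = 1 \<otimes> 1"

definition times_tensor :: "'a \<otimes> 'b \<Rightarrow> 'a \<otimes> 'b \<Rightarrow> 'a \<otimes> 'b" where
  "times_tensor = tensor_mult"

instance
proof
  note D = cbilinearD[OF cbilinear_tensor_mult]
  fix r s t :: "'a \<otimes> 'b" and c
  show "(r + s) * t = r * t + s * t" "r * (s + t) = r * s + r * t"
    "(c *\<^sub>C s) * t = c *\<^sub>C (s * t)" "s * (c *\<^sub>C t) = c *\<^sub>C (s * t)"
    by (simp_all add: times_tensor_def D)
  show "1 * t = t" "t * 1 = t"
    unfolding times_tensor_def one_tensor_def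
    by (rule tensor_ext[of "\<lambda>t. tensor_mult (1 \<otimes> 1) t" "\<lambda>t. t"] tensor_ext[of "\<lambda>t. tensor_mult t (1 \<otimes> 1)" "\<lambda>t. t"];
        simp add: clinear_iff D tensor_mult_pure)+
  show "(0::'a \<otimes> 'b) \<noteq> 1"
    unfolding one_tensor_def using pure_tensor_nonzero[of "1::'a" "1::'b"] by simp
  show "(r * s) * t = r * (s * t)"
    unfolding times_tensor_def
  proof (rule tensor_ext[of "\<lambda>r. tensor_mult (tensor_mult r s) t" "\<lambda>r. tensor_mult r (tensor_mult s t)"])
    fix a :: 'a and b :: 'b
    show "tensor_mult (tensor_mult (a \<otimes> b) s) t = tensor_mult (a \<otimes> b) (tensor_mult s t)"
    proof (rule tensor_ext[of "\<lambda>s. tensor_mult (tensor_mult (a \<otimes> b) s) t" "\<lambda>s. tensor_mult (a \<otimes> b) (tensor_mult s t)"])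
      fix c :: 'a and d :: 'b
      show "tensor_mult (tensor_mult (a \<otimes> b) (c \<otimes> d)) t = tensor_mult (a \<otimes> b) (tensor_mult (c \<otimes> d) t)"
        by (rule tensor_ext[of "\<lambda>t. tensor_mult (tensor_mult (a \<otimes> b) (c \<otimes> d)) t" "\<lambda>t. tensor_mult (a \<otimes> b) (tensor_mult (c \<otimes> d) t)"])
          (simp_all add: clinear_iff D tensor_mult_pure mult.assoc)
    qed (simp_all add: clinear_iff D)
  qed (simp_all add: clinear_iff D)
qed

end

lemma pure_tensor_mult: "(a \<otimes> b) * (c \<otimes> d) = (a * c) \<otimes> (b * d)"
  by (simp add: times_tensor_def tensor_mult_pure)


section \<open>The universal enveloping algebra\<close>

text \<open>The quotient of the free associative algebra on the set of all elements of \<open>\<gg>\<close> by the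
  two-sided ideal which makes the generators linear and turns commutators into brackets; this is
  the tensor algebra of \<open>\<gg>\<close> modulo \<open>x \<otimes> y - y \<otimes> x - [x, y]\<close>.\<close>

datatype 'a word = Word (letters: "'a list")

instantiation word :: (type) monoid_add
begin

definition zero_word :: "'a word" where "zero_word = Word []"

definition plus_word :: "'a word \<Rightarrow> 'a word \<Rightarrow> 'a word" where
  "plus_word v w = Word (letters v @ letters w)"

instance by standard (simp_all add: zero_word_def plus_word_def)

end

lemma letters_add [simp]: "letters (v + w) = letters v @ letters w" "letters 0 = []"
  by (simp_all add: plus_word_def zero_word_def)

definition free_gen :: "'a \<Rightarrow> ('a word \<Rightarrow>\<^sub>0 complex)" where
  "free_gen x = Poly_Mapping.single (Word [x]) 1"

definition uea_relators :: "('g::lie_algebra word \<Rightarrow>\<^sub>0 complex) set" where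
  "uea_relators =
     {free_gen (x + y) - free_gen x - free_gen y | x y. True}
   \<union> {free_gen (c *\<^sub>C x) - c *\<^sub>C free_gen x | c x. True}
   \<union> {free_gen x * free_gen y - free_gen y * free_gen x - free_gen (bracket x y) | x y. True}"

definition uea_ideal :: "('g::lie_algebra word \<Rightarrow>\<^sub>0 complex) set" where
  "uea_ideal = cvec.span {p * r * q | p r q. r \<in> uea_relators}"

definition uea_rel :: "('g::lie_algebra word \<Rightarrow>\<^sub>0 complex) \<Rightarrow> ('g word \<Rightarrow>\<^sub>0 complex) \<Rightarrow> bool" where
  "uea_rel p q \<longleftrightarrow> p - q \<in> uea_ideal"

lemma equivp_uea_rel: "equivp uea_rel"
  using equivp_diff_span unfolding uea_rel_def[abs_def] uea_ideal_def .

quotient_type (overloaded) 'g uea = "'g::lie_algebra word \<Rightarrow>\<^sub>0 complex" / uea_rel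
  by (rule equivp_uea_rel)

lemma poly_mapping_mult_scaleC:
  fixes p q :: "'a::monoid_add \<Rightarrow>\<^sub>0 complex"
  shows "(c *\<^sub>C p) * q = c *\<^sub>C (p * q)" "p * (c *\<^sub>C q) = c *\<^sub>C (p * q)"
proof -
  have C: "c *\<^sub>C p = Poly_Mapping.single 0 c * p" for c and p :: "'a \<Rightarrow>\<^sub>0 complex"
    unfolding mult_map_scale_conv_mult[symmetric] scaleC_poly_mapping_def
    by (simp add: scaleC_complex_def[abs_def])
  show "(c *\<^sub>C p) * q = c *\<^sub>C (p * q)"
    by (simp add: C mult.assoc)
  have S: "(d *\<^sub>C p) * q = d *\<^sub>C (p * q)" for d and p q :: "'a \<Rightarrow>\<^sub>0 complex"
    by (simp add: C mult.assoc)
  have c: "p * Poly_Mapping.single 0 c = c *\<^sub>C p"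
    by (rule clinear_eqI[of "\<lambda>p. p * Poly_Mapping.single 0 c" "scaleC c"])
      (auto intro!: clinearI simp: S distrib_right scaleC_add_right mult_single scaleC_single
        cvec.scale_left_commute)
  have "p * (c *\<^sub>C q) = (p * Poly_Mapping.single 0 c) * q"
    by (simp add: C mult.assoc)
  then show "p * (c *\<^sub>C q) = c *\<^sub>C (p * q)"
    by (simp only: c S)
qed

lemma uea_ideal_mult:
  assumes "p \<in> uea_ideal"
  shows "a * p * b \<in> uea_ideal"
  using assms unfolding uea_ideal_def
proof (induction rule: cvec.span_induct)
  case base
  let ?R = "{p * r * q |p r q. r \<in> uea_relators}"
  show ?case
    by (rule cvec.subspaceI)
      (auto simp: cvec.span_zero distrib_left distrib_right poly_mapping_mult_scaleC
        intro: cvec.span_add cvec.span_scale)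
next
  case (step x)
  then obtain p r q where "x = p * r * q" "r \<in> uea_relators" by blast
  then have "a * x * b = (a * p) * r * (q * b)" by (simp add: mult.assoc)
  then show ?case using \<open>r \<in> uea_relators\<close> by (intro cvec.span_base) blast
qed

text \<open>Conditions on a function on words under which it descends to the enveloping algebra.\<close>

definition uea_compatible :: "('g::lie_algebra list \<Rightarrow> 'a::complex_vector) \<Rightarrow> bool" where
  "uea_compatible h \<longleftrightarrow>
     (\<forall>v w x y. h (v @ (x + y) # w) = h (v @ x # w) + h (v @ y # w)) \<and>
     (\<forall>v w c x. h (v @ (c *\<^sub>C x) # w) = c *\<^sub>C h (v @ x # w)) \<and>
     (\<forall>v w x y. h (v @ bracket x y # w) = h (v @ x # y # w) - h (v @ y # x # w))"

lemma lin_ext_uea_rel: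
  assumes h: "uea_compatible h" and "uea_rel p q"
  shows "lin_ext (h \<circ> letters) p = lin_ext (h \<circ> letters) q"
proof -
  let ?L = "lin_ext (h \<circ> letters)"
  note L = clinearD[OF clinear_lin_ext[of "h \<circ> letters"]]
  have r0: "?L (a * r * b) = 0" if r: "r \<in> uea_relators" for a r b
  proof -
    show ?thesis
    proof (rule clinear_eqI[of "\<lambda>a. ?L (a * r * b)" "\<lambda>_. 0"])
      fix v
      show "?L (Poly_Mapping.single v 1 * r * b) = 0"
      proof (rule clinear_eqI[of "\<lambda>b. ?L (Poly_Mapping.single v 1 * r * b)" "\<lambda>_. 0"])
        fix w
        show "?L (Poly_Mapping.single v 1 * r * Poly_Mapping.single w 1) = 0"
          using r h unfolding uea_relators_def free_gen_def uea_compatible_def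
          by (auto simp: left_diff_distrib right_diff_distrib mult_single L scaleC_one poly_mapping_mult_scaleC)
      qed (auto intro!: clinearI simp: distrib_left poly_mapping_mult_scaleC L)
    qed (auto intro!: clinearI simp: distrib_right poly_mapping_mult_scaleC L)
  qed
  have "?L (p - q) = 0"
    using assms(2) unfolding uea_rel_def uea_ideal_def
    by (rule clinear_vanishes_on_span[OF clinear_lin_ext, rotated]) (auto simp: r0)
  then show ?thesis by (simp add: L)
qed

instantiation uea :: (lie_algebra) complex_algebra_1
begin

lift_definition zero_uea :: "'a uea" is 0 .

lift_definition one_uea :: "'a uea" is 1 .

lift_definition plus_uea :: "'a uea \<Rightarrow> 'a uea \<Rightarrow> 'a uea" is "(+)"
  unfolding uea_rel_def uea_ideal_def by (rule diff_span_closed)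

lift_definition uminus_uea :: "'a uea \<Rightarrow> 'a uea" is uminus
  unfolding uea_rel_def uea_ideal_def by (rule diff_span_closed)

lift_definition minus_uea :: "'a uea \<Rightarrow> 'a uea \<Rightarrow> 'a uea" is "(-)"
  unfolding uea_rel_def uea_ideal_def by (rule diff_span_closed)

lift_definition scaleC_uea :: "complex \<Rightarrow> 'a uea \<Rightarrow> 'a uea" is scaleC
  unfolding uea_rel_def uea_ideal_def by (rule diff_span_closed)

lift_definition times_uea :: "'a uea \<Rightarrow> 'a uea \<Rightarrow> 'a uea" is "(*)"
proof -
  fix p p' q q' :: "'a word \<Rightarrow>\<^sub>0 complex"
  assume "uea_rel p p'" "uea_rel q q'"
  then have "1 * (p - p') * q \<in> uea_ideal" "p' * (q - q') * 1 \<in> uea_ideal"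
    unfolding uea_rel_def by (blast intro: uea_ideal_mult)+
  then have "1 * (p - p') * q + p' * (q - q') * 1 \<in> uea_ideal"
    unfolding uea_ideal_def by (rule cvec.span_add)
  then show "uea_rel (p * q) (p' * q')"
    unfolding uea_rel_def by (simp add: algebra_simps)
qed

instance
proof
  fix a b c :: "'a uea" and x y :: complex
  note R = equivp_reflp[OF equivp_uea_rel]
  show "x *\<^sub>C (a + b) = x *\<^sub>C a + x *\<^sub>C b" "(x + y) *\<^sub>C a = x *\<^sub>C a + y *\<^sub>C a"
    "x *\<^sub>C y *\<^sub>C a = (x * y) *\<^sub>C a" "1 *\<^sub>C a = a" "a + b + c = a + (b + c)" "a + b = b + a"
    "0 + a = a" "- a + a = 0" "a - b = a + - b" "a * b * c = a * (b * c)"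
    "(a + b) * c = a * c + b * c" "a * (b + c) = a * b + a * c" "1 * a = a" "a * 1 = a"
    "(x *\<^sub>C a) * b = x *\<^sub>C (a * b)" "a * (x *\<^sub>C b) = x *\<^sub>C (a * b)"
    by (transfer, simp add: R algebra_simps scaleC_add_right scaleC_add_left scaleC_scaleC scaleC_one
        poly_mapping_mult_scaleC)+
  show "(0::'a uea) \<noteq> 1"
  proof transfer
    define h :: "'a list \<Rightarrow> complex" where "h w = (if w = [] then 1 else 0)" for w
    have "uea_compatible h" by (simp add: uea_compatible_def h_def scaleC_complex_def)
    then have "lin_ext (h \<circ> letters) 0 = lin_ext (h \<circ> letters) 1"
      if "uea_rel (0 :: 'a word \<Rightarrow>\<^sub>0 complex) 1"
      using that by (rule lin_ext_uea_rel)
    moreover have "lin_ext (h \<circ> letters) 0 = 0" by (rule clinearD(3)[OF clinear_lin_ext])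
    moreover have "lin_ext (h \<circ> letters) 1 = 1"
      using lin_ext_single[of "h \<circ> letters" 0 1] by (simp add: h_def scaleC_complex_def)
    ultimately show "\<not> uea_rel (0 :: 'a word \<Rightarrow>\<^sub>0 complex) 1" by auto
  qed
qed

end

lift_definition uea_incl :: "'g::lie_algebra \<Rightarrow> 'g uea" (\<open>\<iota>\<close>) is free_gen .

text \<open>The linear map on \<open>U(\<gg>)\<close> with \<open>x\<^sub>1 \<cdots> x\<^sub>n \<mapsto> h [x\<^sub>1, \<dots>, x\<^sub>n]\<close>; well defined when
  \<open>h\<close> is \<^const>\<open>uea_compatible\<close>, see \<open>uea_extend_word\<close>.\<close>

definition uea_extend :: "('g::lie_algebra list \<Rightarrow> 'a::complex_vector) \<Rightarrow> 'g uea \<Rightarrow> 'a" where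
  "uea_extend h u = lin_ext (h \<circ> letters) (rep_uea u)"

lemma uea_incl_linear: "\<iota> (x + y) = \<iota> x + \<iota> y" "\<iota> (c *\<^sub>C x) = c *\<^sub>C \<iota> x"
  and uea_incl_bracket: "\<iota> (bracket x y) = \<iota> x * \<iota> y - \<iota> y * \<iota> x"
proof -
  have I: "uea_rel p q" if "p - q \<in> uea_relators" for p q :: "'a word \<Rightarrow>\<^sub>0 complex"
  proof -
    have "1 * (p - q) * 1 \<in> uea_ideal"
      unfolding uea_ideal_def by (rule cvec.span_base) (use that in blast)
    then show ?thesis by (simp add: uea_rel_def)
  qed
  show "\<iota> (x + y) = \<iota> x + \<iota> y"
    by transfer (rule I, unfold diff_diff_eq[symmetric] uea_relators_def, blast)
  show "\<iota> (c *\<^sub>C x) = c *\<^sub>C \<iota> x"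
    by transfer (rule I, unfold uea_relators_def, blast)
  show "\<iota> (bracket x y) = \<iota> x * \<iota> y - \<iota> y * \<iota> x"
    by transfer (rule equivp_symp[OF equivp_uea_rel], rule I, unfold uea_relators_def, blast)
qed

lemma uea_word_abs: "prod_list (map \<iota> w) = abs_uea (Poly_Mapping.single (Word w) 1)"
proof (induction w)
  case Nil
  then show ?case by (simp add: one_uea.abs_eq flip: single_one zero_word_def)
next
  case (Cons x w)
  then show ?case
    by (simp add: uea_incl.abs_eq times_uea.abs_eq free_gen_def mult_single plus_word_def)
qed

lemma clinear_abs_uea: "clinear abs_uea"
  by (rule clinearI) (simp_all add: plus_uea.abs_eq scaleC_uea.abs_eq)

lemma abs_uea_surj: obtains p where "u = abs_uea p"
  using Quotient3_abs_rep[OF Quotient3_uea] by metis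

lemma uea_ext:
  assumes "clinear f" "clinear g" "\<And>w. f (prod_list (map \<iota> w)) = g (prod_list (map \<iota> w))"
  shows "f u = g u"
proof -
  obtain p where p: "u = abs_uea p" by (rule abs_uea_surj)
  have "(f \<circ> abs_uea) p = (g \<circ> abs_uea) p"
  proof (rule clinear_eqI)
    show "clinear (f \<circ> abs_uea)" "clinear (g \<circ> abs_uea)"
      by (auto intro!: clinearI simp: clinearD[OF assms(1)] clinearD[OF assms(2)] clinearD[OF clinear_abs_uea])
    show "(f \<circ> abs_uea) (Poly_Mapping.single k 1) = (g \<circ> abs_uea) (Poly_Mapping.single k 1)" for k
      using assms(3)[of "letters k"] by (simp add: uea_word_abs)
  qed
  then show ?thesis by (simp add: p)
qed

lemma uea_extend_abs:
  assumes "uea_compatible h"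
  shows "uea_extend h (abs_uea p) = lin_ext (h \<circ> letters) p"
  unfolding uea_extend_def
  by (rule lin_ext_uea_rel[OF assms])
    (rule Quotient3_rep_abs[OF Quotient3_uea equivp_reflp[OF equivp_uea_rel]])

lemma clinear_uea_extend:
  assumes "uea_compatible h"
  shows "clinear (uea_extend h)"
proof (rule clinearI)
  fix u v :: "'a uea" and c
  obtain p q where [simp]: "u = abs_uea p" "v = abs_uea q"
    by (meson abs_uea_surj)
  show "uea_extend h (u + v) = uea_extend h u + uea_extend h v"
    by (simp add: plus_uea.abs_eq uea_extend_abs[OF assms] clinearD[OF clinear_lin_ext])
  show "uea_extend h (c *\<^sub>C u) = c *\<^sub>C uea_extend h u"
    by (simp add: scaleC_uea.abs_eq uea_extend_abs[OF assms] clinearD[OF clinear_lin_ext])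
qed

lemma uea_extend_word:
  assumes "uea_compatible h"
  shows "uea_extend h (prod_list (map \<iota> w)) = h w"
  by (simp add: uea_word_abs uea_extend_abs[OF assms] scaleC_one)

text \<open>The universal property: a Lie algebra map \<open>\<phi>\<close> into an algebra extends to an algebra map.\<close>

definition uea_lift :: "('g::lie_algebra \<Rightarrow> 'a::complex_algebra_1) \<Rightarrow> 'g uea \<Rightarrow> 'a" where
  "uea_lift \<phi> = uea_extend (\<lambda>w. prod_list (map \<phi> w))"

lemma uea_lift:
  assumes "clinear \<phi>" "\<And>x y. \<phi> (bracket x y) = \<phi> x * \<phi> y - \<phi> y * \<phi> x"
  shows "clinear (uea_lift \<phi>)" "uea_lift \<phi> (\<iota> x) = \<phi> x" "uea_lift \<phi> 1 = 1"
    "uea_lift \<phi> (u * v) = uea_lift \<phi> u * uea_lift \<phi> v"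
proof -
  have C: "uea_compatible (\<lambda>w. prod_list (map \<phi> w))"
    by (simp add: uea_compatible_def clinearD[OF assms(1)] assms(2) algebra_simps
        mult_scaleC_left mult_scaleC_right)
  show L: "clinear (uea_lift \<phi>)"
    unfolding uea_lift_def by (rule clinear_uea_extend[OF C])
  have W: "uea_lift \<phi> (prod_list (map \<iota> w)) = prod_list (map \<phi> w)" for w
    unfolding uea_lift_def by (rule uea_extend_word[OF C])
  show "uea_lift \<phi> (\<iota> x) = \<phi> x" "uea_lift \<phi> 1 = 1"
    using W[of "[x]"] W[of "[]"] by simp_all
  show "uea_lift \<phi> (u * v) = uea_lift \<phi> u * uea_lift \<phi> v"
  proof (rule uea_ext[of "\<lambda>u. uea_lift \<phi> (u * v)"])
    fix w
    show "uea_lift \<phi> (prod_list (map \<iota> w) * v) = uea_lift \<phi> (prod_list (map \<iota> w)) * uea_lift \<phi> v"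
    proof (rule uea_ext[of "\<lambda>v. uea_lift \<phi> (prod_list (map \<iota> w) * v)"])
      fix w'
      show "uea_lift \<phi> (prod_list (map \<iota> w) * prod_list (map \<iota> w'))
          = uea_lift \<phi> (prod_list (map \<iota> w)) * uea_lift \<phi> (prod_list (map \<iota> w'))"
        using W[of "w @ w'"] by (simp add: W)
    qed (auto intro!: clinearI simp: clinearD[OF L] algebra_simps mult_scaleC_right)
  qed (auto intro!: clinearI simp: clinearD[OF L] algebra_simps mult_scaleC_left)
qed

definition uea_comul :: "'g::lie_algebra uea \<Rightarrow> 'g uea \<otimes> 'g uea" where
  "uea_comul = uea_lift (\<lambda>x. \<iota> x \<otimes> 1 + 1 \<otimes> \<iota> x)"

definition uea_counit :: "'g::lie_algebra uea \<Rightarrow> complex" where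
  "uea_counit = uea_lift (\<lambda>_. 0)"

text \<open>The anti-automorphism with \<open>\<iota> x \<mapsto> - \<iota> x\<close>.\<close>

definition uea_antipode :: "'g::lie_algebra uea \<Rightarrow> 'g uea" where
  "uea_antipode = uea_extend (\<lambda>w. prod_list (rev (map (\<lambda>x. - \<iota> x) w)))"

text \<open>The extension to \<open>U(\<gg>)\<close> of an action of \<open>\<gg>\<close>: \<open>(x\<^sub>1 \<cdots> x\<^sub>n) \<rhd> f = x\<^sub>1 \<rhd> (\<cdots> (x\<^sub>n \<rhd> f))\<close>.\<close>

definition uea_action :: "('g::lie_algebra \<Rightarrow> 'f::complex_vector \<Rightarrow> 'f) \<Rightarrow> 'g uea \<Rightarrow> 'f \<Rightarrow> 'f" where
  "uea_action act u f = uea_extend (\<lambda>w. foldr act w f) u"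

definition lie_action :: "('g::lie_algebra \<Rightarrow> 'f::complex_vector \<Rightarrow> 'f) \<Rightarrow> bool" where
  "lie_action act \<longleftrightarrow>
     cbilinear act \<and> (\<forall>x y f. act (bracket x y) f = act x (act y f) - act y (act x f))"

lemma uea_comul:
  fixes u v :: "'g::lie_algebra uea" and x :: 'g
  shows "clinear (uea_comul :: 'g uea \<Rightarrow> 'g uea \<otimes> 'g uea)"
    and "uea_comul (\<iota> x) = \<iota> x \<otimes> 1 + 1 \<otimes> \<iota> x"
    and "uea_comul (1 :: 'g uea) = 1"
    and "uea_comul (u * v) = uea_comul u * uea_comul v"
proof -
  have 1: "clinear (\<lambda>x. \<iota> x \<otimes> 1 + 1 \<otimes> \<iota> x :: 'g uea \<otimes> 'g uea)"
    by (rule clinearI) (simp_all add: uea_incl_linear pure_tensor_linear scaleC_add_right)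
  have "clinear (\<lambda>s. s \<otimes> (1 :: 'g uea) :: 'g uea \<otimes> 'g uea)" "clinear (\<lambda>s. (1 :: 'g uea) \<otimes> s :: 'g uea \<otimes> 'g uea)"
    by (auto intro!: clinearI simp: pure_tensor_linear)
  note D = this[THEN clinearD(5)]
  have 2: "\<iota> (bracket x y) \<otimes> 1 + 1 \<otimes> \<iota> (bracket x y) =
      (\<iota> x \<otimes> 1 + 1 \<otimes> \<iota> x) * (\<iota> y \<otimes> 1 + 1 \<otimes> \<iota> y) - (\<iota> y \<otimes> 1 + 1 \<otimes> \<iota> y) * (\<iota> x \<otimes> 1 + 1 \<otimes> \<iota> x)" for x y :: 'g
    by (simp add: uea_incl_bracket D distrib_left distrib_right pure_tensor_mult)
  show "clinear (uea_comul :: 'g uea \<Rightarrow> 'g uea \<otimes> 'g uea)"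
    "uea_comul (\<iota> x) = \<iota> x \<otimes> 1 + 1 \<otimes> \<iota> x" "uea_comul (1 :: 'g uea) = 1"
    "uea_comul (u * v) = uea_comul u * uea_comul v"
    unfolding uea_comul_def by (rule uea_lift[OF 1 2])+
qed

lemma uea_counit:
  fixes u v :: "'g::lie_algebra uea" and x :: 'g
  shows "clinear (uea_counit :: 'g uea \<Rightarrow> complex)"
    and "uea_counit (\<iota> x) = 0"
    and "uea_counit (1 :: 'g uea) = 1"
    and "uea_counit (u * v) = uea_counit u * uea_counit v"
proof -
  have 1: "clinear (\<lambda>_::'g. 0::complex)" by (rule clinearI) (simp_all add: scaleC_complex_def)
  show "clinear (uea_counit :: 'g uea \<Rightarrow> complex)" "uea_counit (\<iota> x) = 0" "uea_counit (1 :: 'g uea) = 1"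
    "uea_counit (u * v) = uea_counit u * uea_counit v"
    unfolding uea_counit_def by (rule uea_lift[OF 1], simp)+
qed

lemma uea_antipode:
  fixes u v :: "'g::lie_algebra uea" and x :: 'g
  shows "clinear (uea_antipode :: 'g uea \<Rightarrow> 'g uea)"
    and "uea_antipode (\<iota> x) = - \<iota> x"
    and "uea_antipode (1 :: 'g uea) = 1"
    and "uea_antipode (u * v) = uea_antipode v * uea_antipode u"
proof -
  have C: "uea_compatible (\<lambda>w. prod_list (rev (map (\<lambda>x. - \<iota> x) w)) :: 'g uea)"
    by (simp add: uea_compatible_def uea_incl_linear uea_incl_bracket algebra_simps
        mult_scaleC_left mult_scaleC_right)
  show L: "clinear (uea_antipode :: 'g uea \<Rightarrow> 'g uea)"
    unfolding uea_antipode_def by (rule clinear_uea_extend[OF C])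
  have W: "uea_antipode (prod_list (map \<iota> w)) = prod_list (rev (map (\<lambda>x. - \<iota> x) w))" for w :: "'g list"
    unfolding uea_antipode_def by (rule uea_extend_word[OF C])
  show "uea_antipode (\<iota> x) = - \<iota> x" "uea_antipode (1 :: 'g uea) = 1"
    using W[of "[x]"] W[of "[]"] by simp_all
  show "uea_antipode (u * v) = uea_antipode v * uea_antipode u"
  proof (rule uea_ext[of "\<lambda>u. uea_antipode (u * v)"])
    fix w
    show "uea_antipode (prod_list (map \<iota> w) * v) = uea_antipode v * uea_antipode (prod_list (map \<iota> w))"
    proof (rule uea_ext[of "\<lambda>v. uea_antipode (prod_list (map \<iota> w) * v)"])
      fix w'
      show "uea_antipode (prod_list (map \<iota> w) * prod_list (map \<iota> w'))
          = uea_antipode (prod_list (map \<iota> w')) * uea_antipode (prod_list (map \<iota> w))"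
        using W[of "w @ w'"] by (simp add: W)
    qed (auto intro!: clinearI simp: clinearD[OF L] algebra_simps mult_scaleC_right mult_scaleC_left)
  qed (auto intro!: clinearI simp: clinearD[OF L] algebra_simps mult_scaleC_left mult_scaleC_right)
qed

lemma uea_action:
  assumes "lie_action act"
  shows "cbilinear (uea_action act)" "uea_action act (\<iota> x) f = act x f" "uea_action act 1 f = f"
    "uea_action act (u * v) f = uea_action act u (uea_action act v f)"
proof -
  have B: "cbilinear act" and br: "act (bracket x y) f = act x (act y f) - act y (act x f)" for x y f
    using assms by (auto simp: lie_action_def)
  have F: "clinear (foldr act w)" for w
    by (induction w) (auto intro!: clinearI simp: clinear_iff cbilinearD[OF B])
  have C: "uea_compatible (\<lambda>w. foldr act w f)" for f
    by (simp add: uea_compatible_def cbilinearD[OF B] br clinearD[OF F])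
  have L: "clinear (\<lambda>u. uea_action act u f)" for f
    unfolding uea_action_def by (rule clinear_uea_extend[OF C])
  have W: "uea_action act (prod_list (map \<iota> w)) f = foldr act w f" for w f
    unfolding uea_action_def by (rule uea_extend_word[OF C])
  have L': "clinear (uea_action act u)" for u
  proof (rule clinearI)
    fix f g c
    show "uea_action act u (f + g) = uea_action act u f + uea_action act u g"
      by (rule uea_ext[of "\<lambda>u. uea_action act u (f + g)" "\<lambda>u. uea_action act u f + uea_action act u g"])
        (simp_all add: clinear_iff W clinearD[OF L] clinearD[OF F] scaleC_add_right)
    show "uea_action act u (c *\<^sub>C f) = c *\<^sub>C uea_action act u f"
      by (rule uea_ext[of "\<lambda>u. uea_action act u (c *\<^sub>C f)" "\<lambda>u. c *\<^sub>C uea_action act u f"])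
        (simp_all add: clinear_iff W clinearD[OF L] clinearD[OF F] scaleC_add_right
          scaleC_scaleC mult.commute)
  qed
  show "cbilinear (uea_action act)"
    using L L' by (simp add: cbilinear_def)
  show "uea_action act (\<iota> x) f = act x f" "uea_action act 1 f = f"
    using W[of "[x]"] W[of "[]"] by simp_all
  show "uea_action act (u * v) f = uea_action act u (uea_action act v f)"
  proof (rule uea_ext[of "\<lambda>u. uea_action act (u * v) f"])
    fix w
    show "uea_action act (prod_list (map \<iota> w) * v) f = uea_action act (prod_list (map \<iota> w)) (uea_action act v f)"
    proof (rule uea_ext[of "\<lambda>v. uea_action act (prod_list (map \<iota> w) * v) f"])
      fix w'
      show "uea_action act (prod_list (map \<iota> w) * prod_list (map \<iota> w')) f
          = uea_action act (prod_list (map \<iota> w)) (uea_action act (prod_list (map \<iota> w')) f)"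
        using W[of "w @ w'"] by (simp add: W)
    qed (auto intro!: clinearI simp: clinearD[OF L] clinearD[OF L'] algebra_simps mult_scaleC_right)
  qed (auto intro!: clinearI simp: clinearD[OF L] algebra_simps mult_scaleC_left)
qed


section \<open>Hopf algebras, comodules and matched pairs\<close>

locale hopf_algebra =
  fixes \<Delta> :: "'a::complex_algebra_1 \<Rightarrow> 'a \<otimes> 'a"
    and \<epsilon> :: "'a \<Rightarrow> complex"
    and S :: "'a \<Rightarrow> 'a"
  assumes clinear_comul: "clinear \<Delta>"
    and clinear_counit: "clinear \<epsilon>"
    and clinear_antipode: "clinear S"
    and coassoc: "sweedler (\<Delta> a) (\<lambda>x y. sweedler (\<Delta> x) (\<lambda>p q. p \<otimes> q \<otimes> y))
                = sweedler (\<Delta> a) (\<lambda>x y. sweedler (\<Delta> y) (\<lambda>p q. x \<otimes> p \<otimes> q))"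
    and counit_left: "sweedler (\<Delta> a) (\<lambda>x y. \<epsilon> x *\<^sub>C y) = a"
    and counit_right: "sweedler (\<Delta> a) (\<lambda>x y. \<epsilon> y *\<^sub>C x) = a"
    and comul_one: "\<Delta> 1 = 1 \<otimes> 1"
    and comul_mult: "\<Delta> (a * b) = \<Delta> a * \<Delta> b"
    and counit_one: "\<epsilon> 1 = 1"
    and counit_mult: "\<epsilon> (a * b) = \<epsilon> a * \<epsilon> b"
    and antipode_left: "sweedler (\<Delta> a) (\<lambda>x y. S x * y) = \<epsilon> a *\<^sub>C 1"
    and antipode_right: "sweedler (\<Delta> a) (\<lambda>x y. x * S y) = \<epsilon> a *\<^sub>C 1"
    and bij_antipode: "bij S"

text \<open>A right comodule over the coalgebra \<open>(\<Delta>, \<epsilon>)\<close>.\<close>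

definition right_comodule ::
    "('f::complex_vector \<Rightarrow> 'f \<otimes> 'f) \<Rightarrow> ('f \<Rightarrow> complex) \<Rightarrow> ('v::complex_vector \<Rightarrow> 'v \<otimes> 'f) \<Rightarrow> bool" where
  "right_comodule \<Delta> \<epsilon> \<rho> \<longleftrightarrow>
     clinear \<rho> \<and>
     (\<forall>v. sweedler (\<rho> v) (\<lambda>w f. sweedler (\<rho> w) (\<lambda>x g. x \<otimes> g \<otimes> f))
        = sweedler (\<rho> v) (\<lambda>w f. sweedler (\<Delta> f) (\<lambda>g h. w \<otimes> g \<otimes> h))) \<and>
     (\<forall>v. sweedler (\<rho> v) (\<lambda>w f. \<epsilon> f *\<^sub>C w) = v)"

locale matched_pair =
  F: hopf_algebra \<Delta>\<^sub>F \<epsilon>\<^sub>F S\<^sub>F + U: hopf_algebra \<Delta>\<^sub>U \<epsilon>\<^sub>U S\<^sub>U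
  for \<Delta>\<^sub>F :: "'f::complex_algebra_1 \<Rightarrow> 'f \<otimes> 'f" and \<epsilon>\<^sub>F S\<^sub>F
    and \<Delta>\<^sub>U :: "'u::complex_algebra_1 \<Rightarrow> 'u \<otimes> 'u" and \<epsilon>\<^sub>U S\<^sub>U +
  fixes act :: "'u \<Rightarrow> 'f \<Rightarrow> 'f"  (infixr \<open>\<rhd>\<close> 75)
    and \<rho> :: "'u \<Rightarrow> 'u \<otimes> 'f"
  assumes cbilinear_act: "cbilinear act"
    and act_one: "1 \<rhd> f = f"
    and act_mult: "(u * v) \<rhd> f = u \<rhd> (v \<rhd> f)"
    and module_algebra_mult: "u \<rhd> (f * g) = sweedler (\<Delta>\<^sub>U u) (\<lambda>u\<^sub>1 u\<^sub>2. (u\<^sub>1 \<rhd> f) * (u\<^sub>2 \<rhd> g))"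
    and module_algebra_one: "u \<rhd> 1 = \<epsilon>\<^sub>U u *\<^sub>C 1"
    and comodule: "right_comodule \<Delta>\<^sub>F \<epsilon>\<^sub>F \<rho>"
    and comodule_coalgebra_comul:
      "sweedler (\<rho> u) (\<lambda>v f. sweedler (\<Delta>\<^sub>U v) (\<lambda>v\<^sub>1 v\<^sub>2. v\<^sub>1 \<otimes> v\<^sub>2 \<otimes> f))
     = sweedler (\<Delta>\<^sub>U u) (\<lambda>u\<^sub>1 u\<^sub>2. sweedler (\<rho> u\<^sub>1) (\<lambda>v f. sweedler (\<rho> u\<^sub>2) (\<lambda>w g. v \<otimes> w \<otimes> f * g)))"
    and comodule_coalgebra_counit: "sweedler (\<rho> u) (\<lambda>v f. \<epsilon>\<^sub>U v *\<^sub>C f) = \<epsilon>\<^sub>U u *\<^sub>C 1"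
    and counit_act: "\<epsilon>\<^sub>F (u \<rhd> f) = \<epsilon>\<^sub>U u * \<epsilon>\<^sub>F f"
    and comul_act: "\<Delta>\<^sub>F (u \<rhd> f) =
      sweedler (\<Delta>\<^sub>U u) (\<lambda>u\<^sub>1 u\<^sub>2. sweedler (\<rho> u\<^sub>1) (\<lambda>v g. sweedler (\<Delta>\<^sub>F f) (\<lambda>f\<^sub>1 f\<^sub>2.
        (v \<rhd> f\<^sub>1) \<otimes> g * (u\<^sub>2 \<rhd> f\<^sub>2))))"
    and coaction_one: "\<rho> 1 = 1 \<otimes> 1"
    and coaction_mult: "\<rho> (u * v) =
      sweedler (\<Delta>\<^sub>U u) (\<lambda>u\<^sub>1 u\<^sub>2. sweedler (\<rho> u\<^sub>1) (\<lambda>w f. sweedler (\<rho> v) (\<lambda>z g.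
        (w * z) \<otimes> f * (u\<^sub>2 \<rhd> g))))"
    and exchange:
      "sweedler (\<Delta>\<^sub>U u) (\<lambda>u\<^sub>1 u\<^sub>2. sweedler (\<rho> u\<^sub>2) (\<lambda>v g. v \<otimes> (u\<^sub>1 \<rhd> f) * g))
     = sweedler (\<Delta>\<^sub>U u) (\<lambda>u\<^sub>1 u\<^sub>2. sweedler (\<rho> u\<^sub>1) (\<lambda>v g. v \<otimes> g * (u\<^sub>2 \<rhd> f)))"


section \<open>Hopf algebras over a Lie algebra\<close>

definition lie_basis :: "nat \<Rightarrow> (nat \<Rightarrow> 'g::lie_algebra) \<Rightarrow> bool" where
  "lie_basis N X \<longleftrightarrow>
     inj_on X {1..N} \<and> \<not> cvec.dependent (X ` {1..N}) \<and> cvec.span (X ` {1..N}) = UNIV"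

text \<open>\<open>struct_const N X i j k\<close> is the coefficient \<open>C\<^sup>k\<^sub>i\<^sub>j\<close> of \<open>X\<^sub>k\<close> in \<open>[X\<^sub>i, X\<^sub>j]\<close>.\<close>

definition struct_const :: "nat \<Rightarrow> (nat \<Rightarrow> 'g::lie_algebra) \<Rightarrow> nat \<Rightarrow> nat \<Rightarrow> nat \<Rightarrow> complex" where
  "struct_const N X i j k = cvec.representation (X ` {1..N}) (bracket (X i) (X j)) (X k)"

text \<open>The operation \<open>X \<bullet> (f\<^sup>1 \<otimes> f\<^sup>2)\<close> of \<open>\<gg>\<close> on \<open>\<F> \<otimes> \<F>\<close>.\<close>

definition bullet :: "('g::lie_algebra \<Rightarrow> 'f \<Rightarrow> 'f) \<Rightarrow> ('g \<Rightarrow> 'g \<otimes> 'f) \<Rightarrow>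
    'g \<Rightarrow> 'f \<otimes> 'f \<Rightarrow> 'f::complex_algebra_1 \<otimes> 'f" where
  "bullet act \<rho> x t = sweedler t (\<lambda>f\<^sub>1 f\<^sub>2.
     sweedler (\<rho> x) (\<lambda>y g. act y f\<^sub>1 \<otimes> g * f\<^sub>2) + f\<^sub>1 \<otimes> act x f\<^sub>2)"

text \<open>In \<open>structure_identity\<close>, \<open>f i j\<close> is the coefficient \<open>f\<^sup>i\<^sub>j\<close>; the matrix \<open>f\<close> is determined
  on \<open>{1..N}\<close> by \<open>\<rho>\<close> because the \<open>X i\<close> form a basis.\<close>

locale g_hopf_algebra = hopf_algebra \<Delta> \<epsilon> S
  for \<Delta> :: "'f::{complex_algebra_1, comm_ring_1} \<Rightarrow> 'f \<otimes> 'f" and \<epsilon> S +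
  fixes N :: nat
    and X :: "nat \<Rightarrow> 'g::lie_algebra"
    and act :: "'g \<Rightarrow> 'f \<Rightarrow> 'f"  (infixr \<open>\<rhd>\<close> 75)
    and \<rho> :: "'g \<Rightarrow> 'g \<otimes> 'f"
  assumes basis: "lie_basis N X"
    and lie_action: "lie_action act"
    and derivation: "x \<rhd> (f * g) = (x \<rhd> f) * g + f * (x \<rhd> g)"
    and comodule: "right_comodule \<Delta> \<epsilon> \<rho>"
    and structure_identity: "\<exists>f.
      (\<forall>j\<in>{1..N}. \<rho> (X j) = (\<Sum>i=1..N. X i \<otimes> f i j)) \<and>
      (\<forall>i\<in>{1..N}. \<forall>j\<in>{1..N}. \<forall>k\<in>{1..N}.
         X i \<rhd> f k j - X j \<rhd> f k i =
           (\<Sum>s=1..N. \<Sum>r=1..N. struct_const N X s r k *\<^sub>C (f r i * f s j))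
         + (\<Sum>l=1..N. struct_const N X i j l *\<^sub>C f k l))"
    and comul_act: "\<Delta> (x \<rhd> f) = bullet act \<rho> x (\<Delta> f)"
    and counit_act: "\<epsilon> (x \<rhd> f) = 0"

text \<open>\<open>restricts_to \<rho> \<rho>\<^sub>g\<close>: on the image of \<open>\<gg>\<close> in \<open>U(\<gg>)\<close>, the map \<open>\<rho>\<close> takes values in
  \<open>\<gg> \<otimes> \<F>\<close> and is given there by \<open>\<rho>\<^sub>g\<close>.\<close>

definition restricts_to ::
    "('g::lie_algebra uea \<Rightarrow> 'g uea \<otimes> 'f::complex_vector) \<Rightarrow> ('g \<Rightarrow> 'g \<otimes> 'f) \<Rightarrow> bool" where
  "restricts_to \<rho> \<rho>\<^sub>g \<longleftrightarrow> (\<forall>x. \<rho> (\<iota> x) = sweedler (\<rho>\<^sub>g x) (\<lambda>y f. \<iota> y \<otimes> f))"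

definition extended_coaction ::
    "('g::lie_algebra \<Rightarrow> 'f \<Rightarrow> 'f) \<Rightarrow> ('g \<Rightarrow> 'g \<otimes> 'f) \<Rightarrow> ('g uea \<Rightarrow> 'g uea \<otimes> 'f::complex_algebra_1) \<Rightarrow> bool" where
  "extended_coaction act \<rho>\<^sub>g \<rho> \<longleftrightarrow>
     clinear \<rho> \<and> restricts_to \<rho> \<rho>\<^sub>g \<and> \<rho> 1 = 1 \<otimes> 1 \<and>
     (\<forall>u v. \<rho> (u * v) =
        sweedler (uea_comul u) (\<lambda>u\<^sub>1 u\<^sub>2. sweedler (\<rho> u\<^sub>1) (\<lambda>w f. sweedler (\<rho> v) (\<lambda>z g.
          (w * z) \<otimes> f * uea_action act u\<^sub>2 g))))"

definition uea_coaction ::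
    "('g::lie_algebra \<Rightarrow> 'f \<Rightarrow> 'f) \<Rightarrow> ('g \<Rightarrow> 'g \<otimes> 'f) \<Rightarrow> 'g uea \<Rightarrow> 'g uea \<otimes> 'f::complex_algebra_1" where
  "uea_coaction act \<rho>\<^sub>g = (THE \<rho>. extended_coaction act \<rho>\<^sub>g \<rho>)"

end

theory Submission
  imports Defs "HOL-Library.Multiset"
begin

text \<open>Write \<open>U\<close> for the enveloping algebra of \<open>\<gg>\<close>. Both directions pass between statements about
the generators \<open>\<iota> x\<close> of \<open>U\<close> and statements about all of \<open>U\<close>.

From a \<open>\<gg>\<close>-Hopf algebra to a matched pair. The product rule demanded of the coaction says in
particular that \<open>\<nabla>(x v) = D\<^sub>x (\<nabla> v)\<close>, where \<open>D\<^sub>x (v \<otimes> f) = x\<^sub>0 v \<otimes> x\<^sub>1 f + v \<otimes> (x \<rhd> f)\<close>. So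
\<open>\<nabla>\<close> is forced to be \<open>\<nabla> u = u \<cdot> (1 \<otimes> 1)\<close> for the action of \<open>U\<close> on \<open>U \<otimes> \<F>\<close> in which \<open>x\<close> acts
as \<open>D\<^sub>x\<close>, and it exists as soon as \<open>D\<close> is a Lie action. That is what the structure identity
provides: without coordinates it reads \<open>\<nabla>[x, y] = [x\<^sub>0, y\<^sub>0] \<otimes> x\<^sub>1 y\<^sub>1 + y\<^sub>0 \<otimes> (x \<rhd> y\<^sub>1) -
x\<^sub>0 \<otimes> (y \<rhd> x\<^sub>1)\<close> (\<open>structure_identity_iff\<close>, \<open>lie_action_coact_step\<close>). Each axiom of a
matched pair is then an equation \<open>A u = B u\<close> between linear functions of \<open>u\<close>. It holds at \<open>u
= 1\<close>, and for fixed \<open>x\<close> there is an operator \<open>T\<close> with \<open>A (x u) = T (A u)\<close> and \<open>B (x u) = T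
(B u)\<close>, so it holds on all products of generators. The exchange axiom is the exception: it
follows from cocommutativity of \<open>U\<close> and commutativity of \<open>\<F>\<close>.

From a matched pair to a \<open>\<gg>\<close>-Hopf algebra. Two facts about \<open>U\<close> are used. First, \<open>\<nabla>\<close> maps \<open>\<gg>\<close>
to \<open>\<gg> \<otimes> \<F>\<close>. Compatibility of \<open>\<nabla>\<close> with the comultiplication makes the left legs of \<open>\<nabla> x\<close>
primitive, so that \<open>\<nabla> x\<close> is an eigenvector for the eigenvalue 2 of \<open>\<Psi> \<otimes> id\<close>, where \<open>\<Psi> u =
u\<^sub>1 u\<^sub>2\<close>. But \<open>\<Psi>\<close> is multiplication by \<open>2\<^sup>n\<close> on products of \<open>n\<close> generators up to shorter
products, which leaves only products of length at most one (\<open>doubling_leading\<close>,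
\<open>doubling_eigen\<close>). Second, \<open>\<iota>\<close> is injective, with an explicit linear left inverse \<open>U \<rightarrow> \<gg>\<close>,
read off from the representation of \<open>\<gg>\<close> on polynomials that underlies the
Poincare-Birkhoff-Witt theorem (\<open>lie_action_pbw_act\<close>, \<open>uea_proj_incl\<close>). Applying this left
inverse to the axioms of the matched pair at \<open>u = \<iota> x\<close> turns them into the axioms of a
\<open>\<gg>\<close>-Hopf algebra.\<close>

section \<open>Calculus with Sweedler sums\<close>

text \<open>A Sweedler sum is a finite weighted sum over one fixed representative of the tensor. It
therefore commutes with linear maps and with other Sweedler sums for every body, bilinear or
not; bilinearity of the body matters only for linearity in the tensor and for evaluation at
pure tensors.\<close>

lemma sweedler_plus: "sweedler t (\<lambda>x y. A x y + B x y) = sweedler t A + sweedler t B"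
  by (simp add: sweedler_def lin_ext_def case_prod_beta scaleC_add_right sum.distrib)

lemma sweedler_uminus: "sweedler t (\<lambda>x y. - A x y) = - sweedler t A"
  by (simp add: sweedler_def lin_ext_def case_prod_beta sum_negf)

lemma sweedler_zero: "sweedler t (\<lambda>x y. 0) = 0"
  by (simp add: sweedler_def lin_ext_def)

lemma sweedler_linear:
  assumes "clinear f"
  shows "f (sweedler t B) = sweedler t (\<lambda>x y. f (B x y))"
  by (simp add: sweedler_def lin_ext_def case_prod_beta clinear_sum[OF assms] clinearD(2)[OF assms])

lemma sweedler_swap:
  "sweedler s (\<lambda>a b. sweedler t (\<lambda>c d. P a b c d)) = sweedler t (\<lambda>c d. sweedler s (\<lambda>a b. P a b c d))"
  unfolding sweedler_def lin_ext_def case_prod_beta cvec.scale_sum_right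
  by (subst sum.swap) (simp add: scaleC_scaleC mult.commute)

lemma clinear_ident: "clinear (\<lambda>x. x)"
  and clinear_const_zero: "clinear (\<lambda>x. 0)"
  by (auto intro!: clinearI)

lemma clinear_plus: "clinear f \<Longrightarrow> clinear g \<Longrightarrow> clinear (\<lambda>x. f x + g x)"
  and clinear_minus: "clinear f \<Longrightarrow> clinear g \<Longrightarrow> clinear (\<lambda>x. f x - g x)"
  and clinear_uminus: "clinear f \<Longrightarrow> clinear (\<lambda>x. - f x)"
  by (auto intro!: clinearI simp: clinearD scaleC_add_right cvec.scale_right_diff_distrib)

lemma clinear_compose: "clinear f \<Longrightarrow> clinear g \<Longrightarrow> clinear (\<lambda>x. f (g x))"
  by (auto intro!: clinearI simp: clinearD)

lemma cbilinear_left: "cbilinear B \<Longrightarrow> clinear (\<lambda>x. B x c)"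
  and cbilinear_right: "cbilinear B \<Longrightarrow> clinear (\<lambda>x. B d x)"
  by (auto simp: cbilinear_def)

lemmas cbilinear_comp_left = clinear_compose[OF cbilinear_left]
  and cbilinear_comp_right = clinear_compose[OF cbilinear_right]

lemma cbilinear_mult: "cbilinear (\<lambda>x y::'a::complex_algebra_1. x * y)"
  by (rule cbilinearI) (simp_all add: distrib_left distrib_right mult_scaleC_left mult_scaleC_right)

lemma cbilinear_scaleC: "cbilinear (scaleC :: complex \<Rightarrow> 'a::complex_vector \<Rightarrow> 'a)"
  by (rule cbilinearI) (simp_all add: scaleC_add_right scaleC_add_left scaleC_scaleC
      scaleC_complex_def mult.commute)

lemma clinear_sweedler_comp: "cbilinear B \<Longrightarrow> clinear g \<Longrightarrow> clinear (\<lambda>x. sweedler (g x) B)"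
  by (rule clinear_compose[OF clinear_sweedler])

lemma clinear_sweedler_body:
  assumes "\<And>a b. clinear (\<lambda>x. B x a b)"
  shows "clinear (\<lambda>x. sweedler t (B x))"
  unfolding sweedler_def lin_ext_def case_prod_beta
  by (rule clinearI) (simp_all add: assms[THEN clinearD(1)] assms[THEN clinearD(2)]
      scaleC_add_right sum.distrib cvec.scale_sum_right mult.commute)

text \<open>As conditional rewrite rules these prove \<^term>\<open>clinear\<close> and \<^term>\<open>cbilinear\<close> goals by following the
syntax of the function. Every further linear map \<open>f\<close> contributes two rules, \<open>clinear f\<close> and
\<open>clinear g \<Longrightarrow> clinear (\<lambda>x. f (g x))\<close>, since the simplifier sees \<open>\<lambda>x. f x\<close> only in its
eta-contracted form.\<close>

lemmas clinear_simps = cbilinear_def clinear_ident clinear_const_zero clinear_plus clinear_minus clinear_uminus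
  cbilinear_comp_left[OF cbilinear_mult] cbilinear_comp_right[OF cbilinear_mult]
  cbilinear_comp_left[OF cbilinear_pure] cbilinear_comp_right[OF cbilinear_pure]
  cbilinear_comp_left[OF cbilinear_scaleC] cbilinear_comp_right[OF cbilinear_scaleC]
  cbilinear_left[OF cbilinear_mult] cbilinear_right[OF cbilinear_mult]
  cbilinear_left[OF cbilinear_pure] cbilinear_right[OF cbilinear_pure]
  cbilinear_left[OF cbilinear_scaleC] cbilinear_right[OF cbilinear_scaleC]
  clinear_sweedler clinear_sweedler_comp clinear_sweedler_body

lemma sweedler_add: "cbilinear B \<Longrightarrow> sweedler (s + t) B = sweedler s B + sweedler t B"
  by (rule clinearD(1)[OF clinear_sweedler])

lemma sweedler_sweedler:
  "cbilinear C \<Longrightarrow> sweedler (sweedler t B) C = sweedler t (\<lambda>x y. sweedler (B x y) C)"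
  by (rule sweedler_linear[OF clinear_sweedler])

lemmas pure_zero = clinearD(3)[OF cbilinear_left[OF cbilinear_pure]] clinearD(3)[OF cbilinear_right[OF cbilinear_pure]]

text \<open>Normal form for expressions in Sweedler notation: a sum of nested Sweedler sums whose
innermost body is a single product of pure tensors.\<close>

lemmas sweedler_simps = sweedler_plus sweedler_zero sweedler_pure sweedler_add sweedler_sweedler
  sweedler_linear[OF cbilinear_left[OF cbilinear_mult]] sweedler_linear[OF cbilinear_right[OF
      cbilinear_mult]]
  sweedler_linear[OF cbilinear_left[OF cbilinear_pure]] sweedler_linear[OF cbilinear_right[OF
      cbilinear_pure]]
  sweedler_linear[OF cbilinear_left[OF cbilinear_scaleC]] sweedler_linear[OF cbilinear_right[OF
      cbilinear_scaleC]]
  pure_tensor_linear distrib_left distrib_right mult_scaleC_left mult_scaleC_right pure_tensor_mult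
  scaleC_add_right scaleC_add_left pure_zero

lemma sweedler_minus: "sweedler t (\<lambda>x y. A x y - B x y) = sweedler t A - sweedler t B"
  by (simp add: sweedler_def lin_ext_def case_prod_beta cvec.scale_right_diff_distrib sum_subtractf)

lemma sweedler_diff: "cbilinear B \<Longrightarrow> sweedler (s - t) B = sweedler s B - sweedler t B"
  by (rule clinearD(5)[OF clinear_sweedler])

lemmas sweedler_diff_simps = sweedler_minus sweedler_diff left_diff_distrib right_diff_distrib
  clinearD(5)[OF cbilinear_left[OF cbilinear_pure]] clinearD(5)[OF cbilinear_right[OF
      cbilinear_pure]]

lemma sweedler_sum_pure:
  assumes "cbilinear B"
  shows "sweedler (\<Sum>i\<in>I. x i \<otimes> y i) B = (\<Sum>i\<in>I. B (x i) (y i))"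
  by (simp add: clinear_sum[OF clinear_sweedler[OF assms]] sweedler_pure[OF assms])

lemma clinear_sum_fun: "(\<And>i. clinear (f i)) \<Longrightarrow> clinear (\<lambda>x. \<Sum>i\<in>I. f i x)"
  by (rule cvec_pair.linear_compose_sum) simp

lemmas pure_sum_left = clinear_sum[OF cbilinear_left[OF cbilinear_pure]]
  and pure_sum_right = clinear_sum[OF cbilinear_right[OF cbilinear_pure]]

section \<open>The Hopf algebra structure of the enveloping algebra\<close>

text \<open>The enveloping algebra is spanned by the products of generators, which arise from \<open>1\<close> by
multiplying with generators on the left.\<close>

lemma uea_induct:
  assumes "clinear f" "clinear g" "f 1 = g 1" "\<And>x u. f u = g u \<Longrightarrow> f (\<iota> x * u) = g (\<iota> x * u)"
  shows "f u = g u"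
proof (rule uea_ext[OF assms(1,2)])
  show "f (prod_list (map \<iota> w)) = g (prod_list (map \<iota> w))" for w
    by (induction w) (simp_all add: assms(3,4))
qed

lemma uea_comul_one: "uea_comul (1 :: 'g::lie_algebra uea) = 1 \<otimes> 1"
  by (simp add: uea_comul(3) one_tensor_def)

lemma uea_comul_step:
  "uea_comul (\<iota> x * u) = sweedler (uea_comul u) (\<lambda>p q. (\<iota> x * p) \<otimes> q + p \<otimes> (\<iota> x * q))"
proof -
  have "(\<iota> x \<otimes> 1 + 1 \<otimes> \<iota> x) * t = sweedler t (\<lambda>p q. (\<iota> x * p) \<otimes> q + p \<otimes> (\<iota> x * q))" for t
    by (rule tensor_ext[of "\<lambda>t. (\<iota> x \<otimes> 1 + 1 \<otimes> \<iota> x) * t"]) (simp_all add: clinear_simps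
        sweedler_simps)
  then show ?thesis by (simp add: uea_comul(2,4))
qed

lemma clinear_incl: "clinear \<iota>"
  by (rule clinearI) (simp_all add: uea_incl_linear)

lemmas uea_clinear_simps = clinear_incl clinear_compose[OF clinear_incl]
  uea_comul(1) clinear_compose[OF uea_comul(1)] clinear_compose[OF uea_counit(1)]
 uea_counit(1) uea_antipode(1) clinear_compose[OF uea_antipode(1)]

text \<open>Both sides turn left multiplication of \<open>a\<close> by a generator \<open>x\<close> into the action of \<open>x\<close> on the
threefold tensor power by the Leibniz rule; \<open>T\<close> is that action, and \<open>arg_cong\<close> applies it to
the induction hypothesis.\<close>

lemma uea_coassoc:
 "sweedler (uea_comul a) (\<lambda>x y. sweedler (uea_comul x) (\<lambda>p q. p \<otimes> q \<otimes> y))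
                = sweedler (uea_comul a) (\<lambda>x y. sweedler (uea_comul y) (\<lambda>p q. x \<otimes> p \<otimes> q))" (is
                    "?A a = ?B a")
proof (rule uea_induct[of ?A ?B])
  show "clinear ?A" "clinear ?B"
    by (simp_all add: clinear_simps uea_clinear_simps)
  show "?A 1 = ?B 1"
    by (simp add: uea_comul_one sweedler_simps clinear_simps uea_clinear_simps)
  fix x :: "'a" and u
  assume IH: "?A u = ?B u"
  define T where "T t = sweedler t (\<lambda>a b. sweedler b (\<lambda>b c. (\<iota> x * a) \<otimes> b \<otimes> c + a \<otimes> (\<iota> x * b) \<otimes> c + a \<otimes> b \<otimes> (\<iota> x * c)))" for t
  show "?A (\<iota> x * u) = ?B (\<iota> x * u)"
    using arg_cong[OF IH, of T]
    by (simp add: uea_comul_step sweedler_simps clinear_simps uea_clinear_simps T_def ac_simps)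
qed

lemma uea_counit_left: "sweedler (uea_comul a) (\<lambda>x y. uea_counit x *\<^sub>C y) = a" (is "?A a = a")
proof (rule uea_induct[of ?A "\<lambda>a. a"])
  show "?A (\<iota> x * u) = \<iota> x * u" if "?A u = u" for x u
    using arg_cong[OF that, of "\<lambda>u. \<iota> x * u"]
    by (simp add: uea_comul_step sweedler_simps clinear_simps uea_clinear_simps uea_counit)
qed (simp_all add: clinear_simps uea_clinear_simps uea_counit uea_comul_one sweedler_simps scaleC_one)

lemma uea_counit_right: "sweedler (uea_comul a) (\<lambda>x y. uea_counit y *\<^sub>C x) = a" (is "?A a = a")
proof (rule uea_induct[of ?A "\<lambda>a. a"])
  show "?A (\<iota> x * u) = \<iota> x * u" if "?A u = u" for x u
    using arg_cong[OF that, of "\<lambda>u. \<iota> x * u"]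
    by (simp add: uea_comul_step sweedler_simps clinear_simps uea_clinear_simps uea_counit)
qed (simp_all add: clinear_simps uea_clinear_simps uea_counit uea_comul_one sweedler_simps scaleC_one)

lemma uea_cocommutative: "sweedler (uea_comul u) (\<lambda>p q. q \<otimes> p) = uea_comul u" (is "?A u = _")
proof (rule uea_induct[of ?A uea_comul])
  fix x :: "'a" and u assume IH: "?A u = uea_comul u"
  define T where "T t = sweedler t (\<lambda>p q. (\<iota> x * p) \<otimes> q + p \<otimes> (\<iota> x * q))" for t
  show "?A (\<iota> x * u) = uea_comul (\<iota> x * u)"
    using arg_cong[OF IH, of T]
    by (simp add: uea_comul_step sweedler_simps clinear_simps uea_clinear_simps T_def ac_simps)
qed (simp_all add: clinear_simps uea_clinear_simps uea_comul_one sweedler_simps)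

lemma uea_comul_flip:
  assumes B: "cbilinear B"
  shows "sweedler (uea_comul u) (\<lambda>p q. B q p) = sweedler (uea_comul u) B"
proof -
  show ?thesis
    using arg_cong[OF uea_cocommutative[of u], of "\<lambda>t. sweedler t B"]
    by (simp add: sweedler_sweedler B sweedler_pure)
qed

lemma uea_antipode_antipode: "uea_antipode (uea_antipode u) = u"
  by (rule uea_induct[of "\<lambda>u. uea_antipode (uea_antipode u)" "\<lambda>u. u"])
   (simp_all add: clinear_simps uea_clinear_simps uea_antipode clinearD[OF uea_antipode(1)])

lemma uea_antipode_left: "sweedler (uea_comul a) (\<lambda>x y. uea_antipode x * y) = uea_counit a *\<^sub>C 1" (is "?A a = ?B a")
  by (rule uea_induct[of ?A ?B])
   (simp_all add: clinear_simps uea_clinear_simps uea_comul_one uea_comul_step sweedler_simps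
       uea_counit uea_antipode scaleC_one mult.assoc sweedler_uminus)

text \<open>Unlike on the other side, the extra terms \<open>x u\<^sub>1 S(u\<^sub>2) - u\<^sub>1 S(u\<^sub>2) x\<close> cancel only because
\<open>u\<^sub>1 S(u\<^sub>2)\<close> is a scalar by the induction hypothesis.\<close>

lemma uea_antipode_right: "sweedler (uea_comul a) (\<lambda>x y. x * uea_antipode y) = uea_counit a *\<^sub>C 1" (is "?A a = ?B a")
proof (rule uea_induct[of ?A ?B])
  fix x :: 'a and u assume IH: "?A u = ?B u"
  show "?A (\<iota> x * u) = ?B (\<iota> x * u)"
    using arg_cong[OF IH, of "\<lambda>u. \<iota> x * u + u * (- \<iota> x)"]
    by (simp add: uea_comul_step sweedler_simps clinear_simps uea_clinear_simps uea_counit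
        uea_antipode mult.assoc sweedler_uminus)
qed (simp_all add: clinear_simps uea_clinear_simps uea_comul_one sweedler_simps uea_counit uea_antipode scaleC_one)

lemma hopf_algebra_uea: "hopf_algebra uea_comul uea_counit uea_antipode"
proof (unfold hopf_algebra_def, intro conjI allI)
  show "bij (uea_antipode :: 'a uea \<Rightarrow> _)"
    by (rule o_bij[of uea_antipode]) (simp_all add: fun_eq_iff uea_antipode_antipode)
qed (simp_all only: uea_comul uea_counit uea_antipode uea_coassoc uea_counit_left uea_counit_right
   uea_antipode_left uea_antipode_right one_tensor_def)

section \<open>Coordinates and the structure identity\<close>

definition coord :: "nat \<Rightarrow> (nat \<Rightarrow> 'g::lie_algebra) \<Rightarrow> nat \<Rightarrow> 'g \<Rightarrow> complex" where
  "coord N X k x = cvec.representation (X ` {1..N}) x (X k)"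

lemma clinear_coord:
  assumes "lie_basis N X"
  shows "clinear (coord N X k)"
proof -
  have I: "\<not> cvec.dependent (X ` {1..N})" and S: "\<And>x. x \<in> cvec.span (X ` {1..N})"
    using assms unfolding lie_basis_def by blast+
  show ?thesis
    unfolding coord_def
    by (rule clinearI) (simp_all only: cvec.representation_add[OF I S S]
        cvec.representation_scale[OF I S] scaleC_complex_def)
qed

lemma coord_basis:
  assumes "lie_basis N X" "j \<in> {1..N}" "k \<in> {1..N}"
  shows "coord N X k (X j) = (if k = j then 1 else 0)"
proof -
  have I: "\<not> cvec.dependent (X ` {1..N})" and J: "inj_on X {1..N}"
    using assms(1) unfolding lie_basis_def by blast+
  show ?thesis
    unfolding coord_def cvec.representation_basis[OF I imageI[OF assms(2)]] inj_on_eq_iff[OF J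
        assms(3,2)] by (rule refl)
qed

lemma coord_expansion:
  assumes "lie_basis N X"
  shows "x = (\<Sum>k=1..N. coord N X k x *\<^sub>C X k)"
proof -
  have I: "\<not> cvec.dependent (X ` {1..N})" and S: "\<And>x. x \<in> cvec.span (X ` {1..N})" and J:
      "inj_on X {1..N}"
    using assms unfolding lie_basis_def by blast+
  have "x = (\<Sum>b\<in>X ` {1..N}. cvec.representation (X ` {1..N}) x b *\<^sub>C b)"
    by (rule cvec.sum_representation_eq[OF I S, symmetric]) auto
  also have "\<dots> = (\<Sum>k=1..N. coord N X k x *\<^sub>C X k)"
    by (simp only: sum.reindex[OF J] o_def coord_def)
  finally show ?thesis .
qed

lemma lie_basis_linear_ext:
  assumes "lie_basis N X" "clinear f" "clinear g" "\<And>i. i \<in> {1..N} \<Longrightarrow> f (X i) = g (X i)"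
  shows "f x = g x"
proof -
  let ?s = "\<Sum>k=1..N. coord N X k x *\<^sub>C X k"
  have "f ?s = g ?s"
    by (simp add: clinear_sum[OF assms(2)] clinear_sum[OF assms(3)] clinearD[OF assms(2)]
        clinearD[OF assms(3)] assms(4))
  then show ?thesis
    by (simp only: flip: coord_expansion[OF assms(1), of x])
qed

text \<open>The coefficients \<open>f\<^sup>i\<^sub>j\<close> of a coaction on \<open>\<gg>\<close> are found, and compared, by applying the
coordinate functionals of the basis to the left leg.\<close>

lemma tensor_expansion:
  assumes "lie_basis N X"
  shows "t = (\<Sum>k=1..N. X k \<otimes> sweedler t (\<lambda>y f. coord N X k y *\<^sub>C f))"
proof (rule tensor_ext[of "\<lambda>t. t"])
  note L = clinear_coord[OF assms] clinear_compose[OF clinear_coord[OF assms]]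
  show "clinear (\<lambda>t. \<Sum>k=1..N. X k \<otimes> sweedler t (\<lambda>y f. coord N X k y *\<^sub>C f))"
    by (rule cvec_pair.linear_compose_sum) (simp add: clinear_simps L)
  show "x \<otimes> y = (\<Sum>k=1..N. X k \<otimes> sweedler (x \<otimes> y) (\<lambda>y f. coord N X k y *\<^sub>C f))" for x y
    by (subst coord_expansion[OF assms, of x]) (simp add: sweedler_simps clinear_simps L
        pure_sum_left)
qed (rule clinear_ident)

lemma tensor_coordinates_unique:
  assumes "lie_basis N X" "(\<Sum>k=1..N. X k \<otimes> a k) = (\<Sum>k=1..N. X k \<otimes> b k)" "k \<in> {1..N}"
  shows "a k = b k"
proof -
  note L = clinear_coord[OF assms(1)] clinear_compose[OF clinear_coord[OF assms(1)]]
  have B: "cbilinear (\<lambda>y f. coord N X k y *\<^sub>C f)" by (simp add: clinear_simps L)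
  have "sweedler (\<Sum>k=1..N. X k \<otimes> a k) (\<lambda>y f. coord N X k y *\<^sub>C f) = a k" for a
    using assms(1,3) by (simp add: sweedler_sum_pure[OF B] coord_basis if_distrib[of "\<lambda>c. c *\<^sub>C _"]
       scaleC_one cong: if_cong)
  then show ?thesis using assms(2) by metis
qed

lemma tensor_coordinates_eq_iff:
  assumes "lie_basis N X"
  shows "(\<Sum>k=1..N. X k \<otimes> a k) = (\<Sum>k=1..N. X k \<otimes> b k) \<longleftrightarrow> (\<forall>k\<in>{1..N}. a k = b k)"
proof
  show "(\<Sum>k=1..N. X k \<otimes> a k) = (\<Sum>k=1..N. X k \<otimes> b k)" if "\<forall>k\<in>{1..N}. a k = b k"
    using that by (intro sum.cong) auto
qed (intro ballI, rule tensor_coordinates_unique[OF assms])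

text \<open>The right hand side of the coordinate-free structure identity, \<open>[x\<^sub>0, y\<^sub>0] \<otimes> x\<^sub>1 y\<^sub>1 + y\<^sub>0 \<otimes>
(x \<rhd> y\<^sub>1) - x\<^sub>0 \<otimes> (y \<rhd> x\<^sub>1)\<close>.\<close>

definition lie_structure :: "('g::lie_algebra \<Rightarrow> 'f \<Rightarrow> 'f) \<Rightarrow> ('g \<Rightarrow> 'g \<otimes> 'f::complex_algebra_1) \<Rightarrow> 'g \<Rightarrow> 'g \<Rightarrow> 'g \<otimes> 'f" where
  "lie_structure act \<rho> x y =
     sweedler (\<rho> x) (\<lambda>a f. sweedler (\<rho> y) (\<lambda>b g. bracket a b \<otimes> (f * g)))
     + sweedler (\<rho> y) (\<lambda>b g. b \<otimes> act x g) - sweedler (\<rho> x) (\<lambda>a f. a \<otimes> act y f)"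

lemma cbilinear_bracket: "cbilinear bracket"
  by (rule cbilinearI) (simp_all add: bracket_add_left bracket_add_right bracket_scaleC_left
      bracket_scaleC_right)

lemma bracket_swap: "bracket x y = - bracket y (x :: 'g::lie_algebra)"
proof -
  have "bracket x y + bracket y x = bracket (x + y) (x + y)"
    by (subst bracket_add_left, subst (1 2) bracket_add_right) (simp add: bracket_self)
  then have "bracket x y + bracket y x = 0"
    by (simp only: bracket_self)
  then show ?thesis by (simp only: eq_neg_iff_add_eq_0)
qed

lemmas bracket_linear = cbilinear_left[OF cbilinear_bracket] cbilinear_right[OF cbilinear_bracket]
  cbilinear_comp_left[OF cbilinear_bracket] cbilinear_comp_right[OF cbilinear_bracket]

lemma bracket_expansion:
  assumes "lie_basis N X"
  shows "bracket (X i) (X j) = (\<Sum>k=1..N. struct_const N X i j k *\<^sub>C X k)"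
  unfolding struct_const_def using coord_expansion[OF assms, of "bracket (X i) (X j)"]
  by (simp add: coord_def)

lemma struct_const_swap:
  assumes "lie_basis N X"
  shows "struct_const N X i j k = - struct_const N X j i k"
  using clinearD(4)[OF clinear_coord[OF assms], of k "bracket (X j) (X i)"]
  by (simp add: struct_const_def coord_def flip: bracket_swap)

text \<open>The coefficient of \<open>X\<^sub>k\<close> in \<open>\<nabla>[X\<^sub>i, X\<^sub>j]\<close> is the last sum of the structure identity. In the
term \<open>[x\<^sub>0, y\<^sub>0] \<otimes> x\<^sub>1 y\<^sub>1\<close> the structure constants appear as \<open>C\<^sup>k\<^sub>r\<^sub>s\<close>, with the two lower
indices exchanged; their antisymmetry accounts for the sign with which the quadratic sum
stands on the other side.\<close>

lemma structure_identity_iff: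
  fixes act :: "'g::lie_algebra \<Rightarrow> 'f::{complex_algebra_1, comm_ring_1} \<Rightarrow> 'f"
  assumes X: "lie_basis N X" and \<rho>: "clinear \<rho>" and act: "cbilinear act"
    and f: "\<And>j. j \<in> {1..N} \<Longrightarrow> \<rho> (X j) = (\<Sum>i=1..N. X i \<otimes> f i j)"
  shows "(\<forall>x y. \<rho> (bracket x y) = lie_structure act \<rho> x y) \<longleftrightarrow>
   (\<forall>i\<in>{1..N}. \<forall>j\<in>{1..N}. \<forall>k\<in>{1..N}.
         act (X i) (f k j) - act (X j) (f k i) =
           (\<Sum>s=1..N. \<Sum>r=1..N. struct_const N X s r k *\<^sub>C (f r i * f s j))
         + (\<Sum>l=1..N. struct_const N X i j l *\<^sub>C f k l))" (is "_ \<longleftrightarrow> ?C")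
proof -
  note L = \<rho> clinear_compose[OF \<rho>] cbilinear_left[OF act] cbilinear_right[OF act]
    cbilinear_comp_left[OF act] cbilinear_comp_right[OF act] bracket_linear
  define c where "c i j k = (\<Sum>l=1..N. struct_const N X i j l *\<^sub>C f k l)" for i j k
  define d where "d i j k = act (X i) (f k j) - act (X j) (f k i) -
     (\<Sum>s=1..N. \<Sum>r=1..N. struct_const N X s r k *\<^sub>C (f r i * f s j))" for i j k
  have 1: "\<rho> (bracket (X i) (X j)) = (\<Sum>k=1..N. X k \<otimes> c i j k)"
    if "i \<in> {1..N}" "j \<in> {1..N}" for i j
  proof -
    have "\<rho> (bracket (X i) (X j)) = (\<Sum>l=1..N. \<Sum>k=1..N. struct_const N X i j l *\<^sub>C (X k \<otimes> f k l))"
      by (simp add: bracket_expansion[OF X] clinear_sum[OF \<rho>] clinearD[OF \<rho>] f cvec.scale_sum_right)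
    also have "\<dots> = (\<Sum>k=1..N. X k \<otimes> c i j k)"
      by (subst sum.swap) (simp add: c_def pure_sum_right pure_tensor_linear)
    finally show ?thesis .
  qed
  have 2: "lie_structure act \<rho> (X i) (X j) = (\<Sum>k=1..N. X k \<otimes> d i j k)"
    if "i \<in> {1..N}" "j \<in> {1..N}" for i j
  proof -
    note f' = f[OF that(1)] f[OF that(2)]
    have "sweedler (\<rho> (X i)) (\<lambda>a f. sweedler (\<rho> (X j)) (\<lambda>b g. bracket a b \<otimes> (f * g))) =
       (\<Sum>r=1..N. \<Sum>s=1..N. \<Sum>k=1..N. X k \<otimes> (struct_const N X r s k *\<^sub>C (f r i * f s j)))"
      by (simp add: f' sweedler_sum_pure clinear_simps clinear_sum_fun L bracket_expansion[OF X]
          pure_sum_left pure_tensor_linear)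
    also have "\<dots> = (\<Sum>s=1..N. \<Sum>r=1..N. \<Sum>k=1..N. - (X k \<otimes> (struct_const N X s r k *\<^sub>C (f r i * f s j))))"
      by (subst sum.swap, subst struct_const_swap[OF X]) (simp add: clinearD(4)[OF
          cbilinear_right[OF cbilinear_pure]])
    also have "\<dots> = - (\<Sum>k=1..N. \<Sum>s=1..N. \<Sum>r=1..N. (X k \<otimes> (struct_const N X s r k *\<^sub>C (f r i * f s j))))"
      by (subst (2) sum.swap, subst (1) sum.swap) (simp add: sum_negf)
    also have "\<dots> = (\<Sum>k=1..N. X k \<otimes> - (\<Sum>s=1..N. \<Sum>r=1..N. struct_const N X s r k *\<^sub>C (f r i * f s j)))"
      by (simp add: pure_sum_right sum_negf clinearD(4)[OF cbilinear_right[OF cbilinear_pure]])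
    finally show ?thesis
      unfolding lie_structure_def d_def
      by (simp add: f' sweedler_sum_pure clinear_simps clinear_sum_fun L clinearD(5)[OF
          cbilinear_right[OF cbilinear_pure]]
          clinearD(4)[OF cbilinear_right[OF cbilinear_pure]] sum_subtractf sum_negf)
  qed
  have "(\<forall>x y. \<rho> (bracket x y) = lie_structure act \<rho> x y) \<longleftrightarrow>
    (\<forall>i\<in>{1..N}. \<forall>j\<in>{1..N}. \<rho> (bracket (X i) (X j)) = lie_structure act \<rho> (X i) (X j))"
  proof (intro iffI allI)
    fix x y
    assume *: "\<forall>i\<in>{1..N}. \<forall>j\<in>{1..N}. \<rho> (bracket (X i) (X j)) = lie_structure act \<rho> (X i) (X j)"
    show "\<rho> (bracket x y) = lie_structure act \<rho> x y"
    proof (rule lie_basis_linear_ext[OF X, of "\<lambda>x. \<rho> (bracket x y)"])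
      show "\<rho> (bracket (X i) y) = lie_structure act \<rho> (X i) y" if "i \<in> {1..N}" for i
        by (rule lie_basis_linear_ext[OF X, of "\<lambda>y. \<rho> (bracket (X i) y)"])
          (use * that in \<open>auto simp add: lie_structure_def clinear_simps L\<close>)
    qed (simp_all add: lie_structure_def clinear_simps L)
  qed auto
  also have "\<dots> \<longleftrightarrow> (\<forall>i\<in>{1..N}. \<forall>j\<in>{1..N}. \<forall>k\<in>{1..N}. c i j k = d i j k)"
    by (intro ball_cong refl) (simp only: 1 2 tensor_coordinates_eq_iff[OF X])
  also have "\<dots> \<longleftrightarrow> ?C"
    unfolding c_def d_def by (intro ball_cong refl) (auto simp: algebra_simps)
  finally show ?thesis .
qed

section \<open>From a \<open>\<gg>\<close>-Hopf algebra to a matched pair\<close>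

lemma (in hopf_algebra) comul_mult_sweedler:
  "\<Delta> (a * b) = sweedler (\<Delta> a) (\<lambda>a\<^sub>1 a\<^sub>2. sweedler (\<Delta> b) (\<lambda>b\<^sub>1 b\<^sub>2. (a\<^sub>1 * b\<^sub>1) \<otimes> (a\<^sub>2 * b\<^sub>2)))"
  by (simp add: comul_mult times_tensor_def tensor_mult_def)

text \<open>Below, \<open>\<rho>\<close> is the given coaction on \<open>\<gg>\<close>, and \<open>coaction\<close> its extension to \<open>U\<close>.\<close>

context g_hopf_algebra
begin

lemma cbilinear_act: "cbilinear act"
  and act_bracket: "bracket x y \<rhd> f = x \<rhd> (y \<rhd> f) - y \<rhd> (x \<rhd> f)"
  using lie_action by (auto simp: lie_action_def)

lemma clinear_coaction: "clinear \<rho>"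
  using comodule by (simp add: right_comodule_def)

lemma act_one: "x \<rhd> 1 = 0"
  using derivation[of x 1 1] by simp

text \<open>The matrix of coefficients is chosen inside the axiom; the coordinate-free form gets rid of
it.\<close>

lemma coaction_bracket: "\<rho> (bracket x y) = lie_structure act \<rho> x y"
proof -
  obtain f where "\<And>j. j \<in> {1..N} \<Longrightarrow> \<rho> (X j) = (\<Sum>i=1..N. X i \<otimes> f i j)"
     and "\<forall>i\<in>{1..N}. \<forall>j\<in>{1..N}. \<forall>k\<in>{1..N}.
         X i \<rhd> f k j - X j \<rhd> f k i =
           (\<Sum>s=1..N. \<Sum>r=1..N. struct_const N X s r k *\<^sub>C (f r i * f s j))
         + (\<Sum>l=1..N. struct_const N X i j l *\<^sub>C f k l)"
    using structure_identity by blast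
  then show ?thesis
    using structure_identity_iff[OF basis clinear_coaction cbilinear_act, of f] by blast
qed

lemmas actions_clinear = cbilinear_left[OF cbilinear_act] cbilinear_right[OF cbilinear_act]
  cbilinear_comp_left[OF cbilinear_act] cbilinear_comp_right[OF cbilinear_act]
  clinear_coaction clinear_compose[OF clinear_coaction]
  cbilinear_left[OF uea_action(1)[OF lie_action]] cbilinear_right[OF uea_action(1)[OF lie_action]]
  cbilinear_comp_left[OF uea_action(1)[OF lie_action]] cbilinear_comp_right[OF uea_action(1)[OF
      lie_action]]

lemmas action_clinear_simps = clinear_simps actions_clinear uea_clinear_simps

lemmas action_simps = cbilinearD[OF cbilinear_act] sweedler_linear[OF cbilinear_left[OF cbilinear_act]]
  sweedler_linear[OF cbilinear_right[OF cbilinear_act]]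
  cbilinearD[OF uea_action(1)[OF lie_action]] sweedler_linear[OF cbilinear_left[OF
      uea_action(1)[OF lie_action]]]
  sweedler_linear[OF cbilinear_right[OF uea_action(1)[OF lie_action]]]
  derivation uea_action(2-4)[OF lie_action]

text \<open>The operator \<open>D\<^sub>x\<close> on \<open>U \<otimes> \<F>\<close> by which the product rule for the coaction expresses \<open>\<nabla>(x v)\<close>
through \<open>\<nabla> v\<close>.\<close>

definition coact_step :: "'g \<Rightarrow> 'g uea \<otimes> 'f \<Rightarrow> 'g uea \<otimes> 'f" where
  "coact_step x t = sweedler t (\<lambda>v f. sweedler (\<rho> x) (\<lambda>y g. (\<iota> y * v) \<otimes> (g * f)) + v \<otimes> (x \<rhd> f))"

lemma cbilinear_coact_step: "cbilinear coact_step"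
  unfolding coact_step_def by (simp add: action_clinear_simps)

text \<open>This is the well-definedness of the extended coaction. In \<open>D\<^sub>x D\<^sub>y - D\<^sub>y D\<^sub>x\<close> the mixed
terms \<open>y\<^sub>0 v \<otimes> y\<^sub>1 (x \<rhd> f)\<close> cancel because \<open>x\<close> acts by a derivation. What is left of the
terms in which \<open>x\<close> or \<open>y\<close> coacts is the structure identity, the commutator being collected
in \<open>U\<close> since \<open>x\<^sub>1 y\<^sub>1 = y\<^sub>1 x\<^sub>1\<close> in \<open>\<F>\<close>.\<close>

lemma lie_action_coact_step: "lie_action coact_step"
  unfolding lie_action_def
proof (intro conjI allI)
  note S = cbilinear_left[OF cbilinear_coact_step] cbilinear_right[OF cbilinear_coact_step]
    cbilinear_comp_right[OF cbilinear_coact_step]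
  fix x y t
  show "coact_step (bracket x y) t = coact_step x (coact_step y t) - coact_step y (coact_step x t)"
  proof (rule tensor_ext[of "coact_step (bracket x y)"])
    fix v f
    have step: "coact_step x (v \<otimes> f) = sweedler (\<rho> x) (\<lambda>y g. (\<iota> y * v) \<otimes> (g * f)) + v \<otimes> (x \<rhd> f)"
        for x v f
      by (simp add: coact_step_def sweedler_pure action_clinear_simps)
    have push: "coact_step x (sweedler t B) = sweedler t (\<lambda>a b. coact_step x (B a b))" for x and
        t :: "'g \<otimes> 'f" and B
      by (rule sweedler_linear) (rule S)
    have plus: "coact_step x (s + t) = coact_step x s + coact_step x t" for x s t
      by (rule cbilinearD[OF cbilinear_coact_step])
    have "coact_step (bracket x y) (v \<otimes> f) =
      sweedler (\<rho> x) (\<lambda>a h. sweedler (\<rho> y) (\<lambda>b g. ((\<iota> a * \<iota> b - \<iota> b * \<iota> a) * v) \<otimes> (h * g * f)))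
       + sweedler (\<rho> y) (\<lambda>b g. (\<iota> b * v) \<otimes> ((x \<rhd> g) * f)) - sweedler (\<rho> x) (\<lambda>b g. (\<iota> b * v) \<otimes> ((y \<rhd> g) * f))
       + v \<otimes> (x \<rhd> (y \<rhd> f) - y \<rhd> (x \<rhd> f))"
      by (simp add: step coaction_bracket lie_structure_def sweedler_simps sweedler_diff
          action_clinear_simps act_bracket uea_incl_bracket)
    also have "\<dots> = coact_step x (coact_step y (v \<otimes> f)) - coact_step y (coact_step x (v \<otimes> f))"
      by (simp add: step push plus sweedler_simps sweedler_diff_simps action_clinear_simps
          action_simps ac_simps)
         (simp add: algebra_simps sweedler_swap[of "\<rho> x" "\<rho> y"])
    finally show "coact_step (bracket x y) (v \<otimes> f)
      = coact_step x (coact_step y (v \<otimes> f)) - coact_step y (coact_step x (v \<otimes> f))" .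
  qed (simp_all add: S action_clinear_simps)
qed (rule cbilinear_coact_step)

definition coaction :: "'g uea \<Rightarrow> 'g uea \<otimes> 'f" where
  "coaction u = uea_action coact_step u (1 \<otimes> 1)"

lemma coaction_linear: "clinear coaction"
  unfolding coaction_def by (rule cbilinear_left[OF uea_action(1)[OF lie_action_coact_step]])

lemma coaction_one: "coaction 1 = 1 \<otimes> 1"
  by (simp add: coaction_def uea_action[OF lie_action_coact_step])

lemma coaction_step: "coaction (\<iota> x * u) =
   sweedler (coaction u) (\<lambda>v f. sweedler (\<rho> x) (\<lambda>y g. (\<iota> y * v) \<otimes> (g * f)) + v \<otimes> (x \<rhd> f))"
  by (simp add: coaction_def uea_action[OF lie_action_coact_step])
    (simp add: coact_step_def)

lemmas coaction_clinear_simps = action_clinear_simps coaction_linear clinear_compose[OF coaction_linear]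
lemmas coaction_simps = sweedler_simps action_simps coaction_step uea_comul_step uea_comul_one coaction_one

text \<open>For fixed \<open>v\<close>, both sides satisfy \<open>A (x u) = D\<^sub>x (A u)\<close>: on the left by construction, on the
right because \<open>x\<close> is primitive and acts on the product \<open>u\<^sub>1\<^sub>1 (u\<^sub>2 \<rhd> v\<^sub>1)\<close> in \<open>\<F>\<close> by the
Leibniz rule.\<close>

lemma coaction_mult:
  "coaction (u * v) =
        sweedler (uea_comul u) (\<lambda>u\<^sub>1 u\<^sub>2. sweedler (coaction u\<^sub>1) (\<lambda>w f. sweedler (coaction v) (\<lambda>z g.
          (w * z) \<otimes> f * uea_action act u\<^sub>2 g)))" (is "?A u = ?B u")
proof (rule uea_induct[of ?A ?B])
  fix x u assume IH: "?A u = ?B u"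
  show "?A (\<iota> x * u) = ?B (\<iota> x * u)"
    using arg_cong[OF IH, of "coact_step x"]
    by (simp add: coaction_simps coaction_clinear_simps coact_step_def distrib_left ac_simps
        sweedler_swap[of "\<rho> x"])
qed (simp_all add: coaction_clinear_simps coaction_simps sweedler_pure_id)

lemma restricts_to_coaction: "restricts_to coaction \<rho>"
  unfolding restricts_to_def
proof
  fix x show "coaction (\<iota> x) = sweedler (\<rho> x) (\<lambda>y f. \<iota> y \<otimes> f)"
    using coaction_step[of x 1] by (simp add: coaction_simps coaction_clinear_simps act_one)
qed

text \<open>The product rule with a generator as left factor is the recursion that defines \<open>coaction\<close>.\<close>

lemma extended_coaction_unique:
  assumes "extended_coaction act \<rho> r"
  shows "r = coaction"
proof
  have r: "clinear r" "r (\<iota> x) = sweedler (\<rho> x) (\<lambda>y f. \<iota> y \<otimes> f)" "r 1 = 1 \<otimes> 1"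
    "r (u * v) =
        sweedler (uea_comul u) (\<lambda>u\<^sub>1 u\<^sub>2. sweedler (r u\<^sub>1) (\<lambda>w f. sweedler (r v) (\<lambda>z g.
          (w * z) \<otimes> f * uea_action act u\<^sub>2 g)))" for x u v
    using assms unfolding extended_coaction_def restricts_to_def by blast+
  fix u show "r u = coaction u"
  proof (rule uea_induct[of r coaction])
    fix x u assume IH: "r u = coaction u"
    show "r (\<iota> x * u) = coaction (\<iota> x * u)"
      unfolding r(4) coaction_step uea_comul(2)
      by (simp add: r IH sweedler_simps action_simps coaction_clinear_simps r(1)
          clinear_compose[OF r(1)] sweedler_swap[of "\<rho> x"])
  qed (simp_all add: r coaction_one coaction_linear)
qed

lemma extended_coaction: "extended_coaction act \<rho> coaction"
  unfolding extended_coaction_def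
  by (intro conjI allI coaction_linear restricts_to_coaction coaction_one coaction_mult)

lemma uea_coaction_eq: "uea_coaction act \<rho> = coaction"
  unfolding uea_coaction_def
  by (rule the_equality) (rule extended_coaction, erule extended_coaction_unique)

lemmas hopf_clinear_simps = clinear_comul clinear_compose[OF clinear_comul] clinear_counit clinear_compose[OF clinear_counit]

lemma comul_act_sweedler:
  "\<Delta> (x \<rhd> f) = sweedler (\<Delta> f) (\<lambda>f\<^sub>1 f\<^sub>2. sweedler (\<rho> x) (\<lambda>y g. (y \<rhd> f\<^sub>1) \<otimes> (g * f\<^sub>2)) + f\<^sub>1 \<otimes> (x \<rhd> f\<^sub>2))"
  by (simp add: comul_act bullet_def)

text \<open>The operator \<open>T\<close> on \<open>U \<otimes> \<F> \<otimes> \<F>\<close> is \<open>v \<otimes> f \<otimes> g \<mapsto> x\<^sub>0\<^sub>0 v \<otimes> x\<^sub>0\<^sub>1 f \<otimes> x\<^sub>1 g + v \<otimes> (x\<^sub>0 \<rhd> f) \<otimes>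
x\<^sub>1 g + v \<otimes> f \<otimes> (x \<rhd> g)\<close>. Coacting twice on \<open>x u\<close> gives it directly. For \<open>(id \<otimes> \<Delta>) \<nabla>(x u)\<close>
the first term comes from \<open>\<Delta>\<close> being multiplicative together with coassociativity of the
coaction on \<open>\<gg>\<close>, and the other two are the formula for \<open>\<Delta>(x \<rhd> f)\<close>.\<close>

lemma right_comodule_coaction: "right_comodule \<Delta> \<epsilon> coaction"
  unfolding right_comodule_def
proof (intro conjI allI)
  fix u
  define A where "A t = sweedler t (\<lambda>w f. sweedler (coaction w) (\<lambda>x g. x \<otimes> g \<otimes> f))" for t ::
      "'g uea \<otimes> 'f"
  define B where "B t = sweedler t (\<lambda>w f. sweedler (\<Delta> f) (\<lambda>g h. w \<otimes> g \<otimes> h))" for t :: "'g uea \<otimes> 'f"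
  have "A (coaction u) = B (coaction u)"
  proof (rule uea_induct[of "\<lambda>u. A (coaction u)" "\<lambda>u. B (coaction u)"])
    fix x u assume IH: "A (coaction u) = B (coaction u)"
    define T where "T t = sweedler t (\<lambda>v t. sweedler t (\<lambda>f g.
       sweedler (\<rho> x) (\<lambda>w h. sweedler (\<rho> w) (\<lambda>y k. (\<iota> y * v) \<otimes> (k * f) \<otimes> (h * g)))
       + sweedler (\<rho> x) (\<lambda>w h. v \<otimes> (w \<rhd> f) \<otimes> (h * g)) + v \<otimes> f \<otimes> (x \<rhd> g)))" for t
    have C: "sweedler (\<rho> x) (\<lambda>w h. sweedler (\<rho> w) (\<lambda>y k. (\<iota> y * v) \<otimes> (k * f) \<otimes> (h * g)))
       = sweedler (\<rho> x) (\<lambda>y h. sweedler (\<Delta> h) (\<lambda>k h. (\<iota> y * v) \<otimes> (k * f) \<otimes> (h * g)))" for v f g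
    proof -
      have "sweedler (\<rho> x) (\<lambda>w h. sweedler (\<rho> w) (\<lambda>y k. y \<otimes> k \<otimes> h)) =
       sweedler (\<rho> x) (\<lambda>y h. sweedler (\<Delta> h) (\<lambda>k h. y \<otimes> k \<otimes> h))"
        using comodule by (simp add: right_comodule_def)
      from arg_cong[OF this, of
          "\<lambda>t. sweedler t (\<lambda>y t. sweedler t (\<lambda>k h. (\<iota> y * v) \<otimes> (k * f) \<otimes> (h * g)))"]
      show ?thesis by (simp add: coaction_simps coaction_clinear_simps hopf_clinear_simps)
    qed
    \<comment> \<open>The two sums are nested in this order so that both sides below normalise to the same expression.\<close>
    have M: "\<Delta> (g * f) = sweedler (\<Delta> f) (\<lambda>f\<^sub>1 f\<^sub>2. sweedler (\<Delta> g) (\<lambda>g\<^sub>1 g\<^sub>2. (g\<^sub>1 * f\<^sub>1) \<otimes> (g\<^sub>2 * f\<^sub>2)))" for g f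
      by (subst sweedler_swap) (rule comul_mult_sweedler)
    have "B (coaction (\<iota> x * u)) = T (B (coaction u))"
      unfolding A_def B_def T_def
      by (simp add: coaction_simps coaction_clinear_simps hopf_clinear_simps C M
          comul_act_sweedler sweedler_swap[of "\<rho> x"] add_ac)
    moreover have "A (coaction (\<iota> x * u)) = T (A (coaction u))"
      unfolding A_def B_def T_def
      by (simp add: coaction_simps coaction_clinear_simps hopf_clinear_simps mult.assoc
          sweedler_swap[of "\<rho> x"])
    ultimately show "A (coaction (\<iota> x * u)) = B (coaction (\<iota> x * u))"
      by (simp only: IH)
  qed (simp_all add: A_def B_def coaction_clinear_simps coaction_simps hopf_clinear_simps comul_one)
  then show "sweedler (coaction u) (\<lambda>w f. sweedler (coaction w) (\<lambda>x g. x \<otimes> g \<otimes> f)) =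
      sweedler (coaction u) (\<lambda>w f. sweedler (\<Delta> f) (\<lambda>g h. w \<otimes> g \<otimes> h))"
    by (simp add: A_def B_def)
next
  fix u
  show "sweedler (coaction u) (\<lambda>w f. \<epsilon> f *\<^sub>C w) = u" (is "?A u = u")
  proof (rule uea_induct[of ?A "\<lambda>u. u"])
    fix x u assume IH: "?A u = u"
    have "sweedler (\<rho> x) (\<lambda>w f. \<epsilon> f *\<^sub>C w) = x"
      using comodule by (simp add: right_comodule_def)
    from arg_cong[OF this, of \<iota>] have C: "sweedler (\<rho> x) (\<lambda>w f. \<epsilon> f *\<^sub>C \<iota> w) = \<iota> x"
      by (simp add: sweedler_linear[OF clinear_incl] uea_incl_linear)
    have "?A (\<iota> x * u) = sweedler (\<rho> x) (\<lambda>w f. \<epsilon> f *\<^sub>C \<iota> w) * ?A u"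
      by (simp add: coaction_simps coaction_clinear_simps hopf_clinear_simps counit_mult
          counit_act sweedler_swap[of "\<rho> x"] scaleC_scaleC mult.commute)
    then show "?A (\<iota> x * u) = \<iota> x * u"
      by (simp only: C IH)
  qed (simp_all add: coaction_clinear_simps coaction_simps hopf_clinear_simps counit_one scaleC_one)
qed (rule coaction_linear)

lemma coaction_coalgebra_comul:
      "sweedler (coaction u) (\<lambda>v f. sweedler (uea_comul v) (\<lambda>v\<^sub>1 v\<^sub>2. v\<^sub>1 \<otimes> v\<^sub>2 \<otimes> f))
     = sweedler (uea_comul u) (\<lambda>u\<^sub>1 u\<^sub>2. sweedler (coaction u\<^sub>1) (\<lambda>v f. sweedler (coaction u\<^sub>2) (\<lambda>w g. v \<otimes> w \<otimes> f * g)))"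
  (is "?A u = ?B u")
proof (rule uea_induct[of ?A ?B])
  fix x u assume IH: "?A u = ?B u"
  define T where "T t = sweedler t (\<lambda>v t. sweedler t (\<lambda>w f.
    sweedler (\<rho> x) (\<lambda>y g. (\<iota> y * v) \<otimes> w \<otimes> (g * f) + v \<otimes> (\<iota> y * w) \<otimes> (g * f)) + v \<otimes> w \<otimes> (x \<rhd> f)))" for t
  have A: "?A (\<iota> x * u) = T (?A u)"
    unfolding T_def by (simp add: coaction_simps coaction_clinear_simps sweedler_swap[of "\<rho> x"])
  have B: "?B (\<iota> x * u) = T (?B u)"
    unfolding T_def by (simp add: coaction_simps coaction_clinear_simps sweedler_swap[of "\<rho> x"]
        ac_simps)
  show "?A (\<iota> x * u) = ?B (\<iota> x * u)"
    unfolding A B IH ..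
qed (simp_all add: coaction_clinear_simps coaction_simps)

lemma coaction_coalgebra_counit:
  "sweedler (coaction u) (\<lambda>v f. uea_counit v *\<^sub>C f) = uea_counit u *\<^sub>C 1" (is "?A u = ?B u")
proof (rule uea_induct[of ?A ?B])
  fix x u assume IH: "?A u = ?B u"
  show "?A (\<iota> x * u) = ?B (\<iota> x * u)"
    using arg_cong[OF IH, of "act x"] by (simp add: coaction_simps coaction_clinear_simps
        uea_counit act_one)
qed (simp_all add: coaction_clinear_simps coaction_simps uea_counit)

lemma uea_action_counit: "\<epsilon> (uea_action act u f) = uea_counit u * \<epsilon> f" (is "?A u = ?B u")
proof (rule uea_induct[of ?A ?B])
  show "clinear ?B" by (auto intro!: clinearI simp: clinearD[OF uea_counit(1)] algebra_simps
      scaleC_complex_def)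
qed (simp_all add: coaction_clinear_simps coaction_simps hopf_clinear_simps uea_counit counit_act)

lemma uea_action_one: "uea_action act u 1 = uea_counit u *\<^sub>C 1" (is "?A u = ?B u")
  by (rule uea_induct[of ?A ?B]) (simp_all add: coaction_clinear_simps coaction_simps uea_counit
      act_one scaleC_one)

lemma uea_action_mult: "uea_action act u (f * g) =
   sweedler (uea_comul u) (\<lambda>u\<^sub>1 u\<^sub>2. uea_action act u\<^sub>1 f * uea_action act u\<^sub>2 g)" (is
       "?A u = ?B u")
  by (rule uea_induct[of ?A ?B]) (simp_all add: coaction_clinear_simps coaction_simps)

lemma uea_action_comul: "\<Delta> (uea_action act u f) =
      sweedler (uea_comul u) (\<lambda>u\<^sub>1 u\<^sub>2. sweedler (coaction u\<^sub>1) (\<lambda>v g. sweedler (\<Delta> f) (\<lambda>f\<^sub>1 f\<^sub>2.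
        uea_action act v f\<^sub>1 \<otimes> g * uea_action act u\<^sub>2 f\<^sub>2)))" (is "?A u = ?B u")
proof (rule uea_induct[of ?A ?B])
  fix x u assume IH: "?A u = ?B u"
  show "?A (\<iota> x * u) = ?B (\<iota> x * u)"
    using arg_cong[OF IH, of "bullet act \<rho> x"]
    by (simp add: bullet_def coaction_simps coaction_clinear_simps hopf_clinear_simps
        comul_act_sweedler sweedler_swap[of "\<rho> x"] ac_simps)
qed (simp_all add: coaction_clinear_simps coaction_simps hopf_clinear_simps sweedler_pure_id)

text \<open>After exchanging \<open>u\<^sub>1\<close> and \<open>u\<^sub>2\<close> by cocommutativity, the two sides differ only by the order
of two factors in \<open>\<F>\<close>.\<close>

lemma coaction_exchange:
  "sweedler (uea_comul u) (\<lambda>u\<^sub>1 u\<^sub>2. sweedler (coaction u\<^sub>2) (\<lambda>v g. v \<otimes> uea_action act u\<^sub>1 f * g))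
     = sweedler (uea_comul u) (\<lambda>u\<^sub>1 u\<^sub>2. sweedler (coaction u\<^sub>1) (\<lambda>v g. v \<otimes> g * uea_action act u\<^sub>2 f))"
  by (subst uea_comul_flip[symmetric]) (simp_all add: coaction_clinear_simps mult.commute)

theorem matched_pair_uea:
  "matched_pair \<Delta> \<epsilon> S uea_comul uea_counit uea_antipode (uea_action act) coaction"
proof (intro matched_pair.intro matched_pair_axioms.intro)
  show "hopf_algebra \<Delta> \<epsilon> S" ..
qed (rule hopf_algebra_uea uea_action[OF lie_action] uea_action_mult uea_action_one right_comodule_coaction
   coaction_coalgebra_comul coaction_coalgebra_counit uea_action_counit uea_action_comul
       coaction_one coaction_mult
   coaction_exchange)+

end

section \<open>Embedding the Lie algebra into its enveloping algebra\<close>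

lemma Min_mset_in: "x \<in># M \<Longrightarrow> Min_mset M \<in># M"
  by (rule Min_in) auto

text \<open>A multiset of indices stands for a monomial in commuting variables \<open>z\<^sub>1, \<dots>, z\<^sub>N\<close>. The Lie
algebra is made to act on polynomials so that \<open>X\<^sub>i z\<^sub>M = z\<^sub>i z\<^sub>M\<close> whenever \<open>i\<close> does not
exceed any index in \<open>M\<close>. In particular \<open>\<iota> (X\<^sub>i)\<close> maps \<open>1\<close> to \<open>z\<^sub>i\<close>, which recovers an
element of \<open>\<gg>\<close> from its image in \<open>U\<close>.\<close>

locale finite_lie_basis =
  fixes N :: nat and X :: "nat \<Rightarrow> 'g::lie_algebra"
  assumes basis: "lie_basis N X"
begin

abbreviation pbw_monom :: "nat multiset \<Rightarrow> nat multiset \<Rightarrow>\<^sub>0 complex" where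
  "pbw_monom M \<equiv> Poly_Mapping.single M 1"

text \<open>\<open>gen_act i M\<close> is \<open>X\<^sub>i z\<^sub>M\<close>. If \<open>M = j M'\<close> with minimal index \<open>j < i\<close>, then \<open>z\<^sub>M = X\<^sub>j z\<^sub>M'\<close>,
and the wish that the bracket be respected dictates \<open>X\<^sub>i z\<^sub>M = X\<^sub>j (X\<^sub>i z\<^sub>M') + [X\<^sub>i, X\<^sub>j]
z\<^sub>M'\<close>. Splitting off the leading term \<open>z\<^sub>i z\<^sub>M'\<close> of \<open>X\<^sub>i z\<^sub>M'\<close>, on which \<open>X\<^sub>j\<close> acts by
multiplication, leaves \<open>X\<^sub>j\<close> acting on monomials of smaller size than \<open>M\<close>. The test \<open>size K
< size M\<close> holds for every monomial \<open>K\<close> that occurs when all indices lie in \<open>{1..N}\<close>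
(\<open>gen_act_leading\<close>); it stands there because termination cannot depend on that.\<close>

function gen_act :: "nat \<Rightarrow> nat multiset \<Rightarrow> (nat multiset \<Rightarrow>\<^sub>0 complex)" where
  "gen_act i M = (if \<forall>j\<in>#M. i \<le> j then pbw_monom (add_mset i M)
     else pbw_monom (add_mset i M)
       + lin_ext (\<lambda>K. if size K < size M then gen_act (Min_mset M) K else 0)
           (gen_act i (M - {#Min_mset M#}) - pbw_monom (add_mset i (M - {#Min_mset M#})))
       + (\<Sum>k=1..N. struct_const N X i (Min_mset M) k *\<^sub>C gen_act k (M - {#Min_mset M#})))"
  by pat_completeness auto
termination
  by (relation "measure (\<lambda>(i, M). size M)")
     (auto intro!: size_Diff1_less intro: Min_mset_in)

declare gen_act.simps [simp del]

text \<open>Polynomials of degree at most \<open>n\<close>. Indices outside \<open>{1..N}\<close> have to be kept out: the values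
of \<open>X\<close> there are arbitrary.\<close>

definition low :: "nat \<Rightarrow> (nat multiset \<Rightarrow>\<^sub>0 complex) set" where
  "low n = {v. \<forall>M\<in>Poly_Mapping.keys v. size M \<le> n \<and> set_mset M \<subseteq> {1..N}}"

lemma subspace_low: "cvec.subspace (low n)"
proof (rule cvec.subspaceI)
  show "x + y \<in> low n" if "x \<in> low n" "y \<in> low n" for x y
    using that keys_add[of x y] unfolding low_def by blast
  show "c *\<^sub>C x \<in> low n" if "x \<in> low n" for c x
    using that unfolding low_def by (auto simp: in_keys_iff lookup_scaleC)
qed (simp add: low_def)

lemmas low_closed = cvec.subspace_add[OF subspace_low] cvec.subspace_diff[OF subspace_low]
  cvec.subspace_scale[OF subspace_low] cvec.subspace_sum[OF subspace_low] cvec.subspace_0[OF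
      subspace_low]

lemma low_mono: "v \<in> low m \<Longrightarrow> m \<le> n \<Longrightarrow> v \<in> low n"
  by (auto simp: low_def)

lemma pbw_monom_low: "size M \<le> n \<Longrightarrow> set_mset M \<subseteq> {1..N} \<Longrightarrow> pbw_monom M \<in> low n"
  by (simp add: low_def)

lemma lin_ext_low:
  assumes "v \<in> low m" "\<And>M. size M \<le> m \<Longrightarrow> set_mset M \<subseteq> {1..N} \<Longrightarrow> h M \<in> low n"
  shows "lin_ext h v \<in> low n"
  using assms unfolding lin_ext_def by (auto intro!: low_closed simp: low_def[of m])

lemma gen_act_leading:
  assumes "i \<in> {1..N}" "set_mset M \<subseteq> {1..N}"
  shows "gen_act i M - pbw_monom (add_mset i M) \<in> low (size M)"
  using assms
proof (induction "size M" arbitrary: i M rule: less_induct)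
  case less
  show ?case
  proof (cases "\<forall>j\<in>#M. i \<le> j")
    case True
    then show ?thesis by (simp add: gen_act.simps[of i M] low_closed)
  next
    case False
    define j M' where "j = Min_mset M" and "M' = M - {#j#}"
    have "j \<in># M" using False by (auto simp: j_def intro: Min_mset_in)
    then have M: "M = add_mset j M'" and j: "j \<in> {1..N}" and M': "set_mset M' \<subseteq> {1..N}"
      using less.prems(2) by (auto simp: M'_def dest: in_diffD)
    have act: "gen_act k K \<in> low (Suc (size K))"
      if "size K < size M" "k \<in> {1..N}" "set_mset K \<subseteq> {1..N}" for k K
    proof -
      have "gen_act k K - pbw_monom (add_mset k K) \<in> low (Suc (size K))"
        using less.hyps[OF that] low_mono by simp
      moreover have "pbw_monom (add_mset k K) \<in> low (Suc (size K))"
        using that by (intro pbw_monom_low) auto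
      ultimately show ?thesis
        using low_closed(1) by fastforce
    qed
    have w: "gen_act i M' - pbw_monom (add_mset i M') \<in> low (size M')"
      by (rule less.hyps) (use less.prems M' M in auto)
    have "lin_ext (\<lambda>K. if size K < size M then gen_act j K else 0)
           (gen_act i M' - pbw_monom (add_mset i M')) \<in> low (size M)"
    proof (rule lin_ext_low[OF w])
      fix K assume K: "size K \<le> size M'" "set_mset K \<subseteq> {1..N}"
      then have "size K < size M" by (simp add: M)
      from act[OF this j K(2)] low_mono[of _ "Suc (size K)" "size M"] this
      show "(if size K < size M then gen_act j K else 0) \<in> low (size M)" by simp
    qed
    moreover have "(\<Sum>k=1..N. struct_const N X i j k *\<^sub>C gen_act k M') \<in> low (size M)"
      using act[of M'] M' by (intro low_closed) (auto simp: M)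
    ultimately have "lin_ext (\<lambda>K. if size K < size M then gen_act j K else 0)
        (gen_act i M' - pbw_monom (add_mset i M')) + (\<Sum>k=1..N. struct_const N X i j k *\<^sub>C gen_act k M') \<in> low (size M)"
      by (rule low_closed)
    moreover have "gen_act i M = pbw_monom (add_mset i M) + lin_ext (\<lambda>K. if size K < size M then gen_act j K else 0)
        (gen_act i M' - pbw_monom (add_mset i M')) + (\<Sum>k=1..N. struct_const N X i j k *\<^sub>C gen_act k M')"
      by (simp only: gen_act.simps[of i M] False if_False flip: j_def M'_def)
    ultimately show ?thesis
      by (simp only: add.assoc add_diff_cancel_left')
  qed
qed

text \<open>The bilinear extension of \<open>gen_act\<close>. Monomials with an index outside \<open>{1..N}\<close> are sent to
\<open>0\<close>, where the bracket is respected trivially.\<close>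

definition pbw_act :: "'g \<Rightarrow> (nat multiset \<Rightarrow>\<^sub>0 complex) \<Rightarrow> (nat multiset \<Rightarrow>\<^sub>0 complex)" where
  "pbw_act x = lin_ext (\<lambda>M. if set_mset M \<subseteq> {1..N} then \<Sum>k=1..N. coord N X k x *\<^sub>C gen_act k M else 0)"

lemma cbilinear_pbw_act: "cbilinear pbw_act"
proof -
  note C = clinearD[OF clinear_coord[OF basis]]
  have "clinear (\<lambda>x. pbw_act x v)" for v
  proof -
    have *: "clinear (\<lambda>x. if set_mset M \<subseteq> {1..N} then \<Sum>k=1..N. coord N X k x *\<^sub>C gen_act k M else 0)" for M
      by (cases "set_mset M \<subseteq> {1..N}")
        (simp_all only: if_True if_False clinear_const_zero clinear_sum_fun[OF
            cbilinear_comp_left[OF cbilinear_scaleC clinear_coord[OF basis]]])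
    show ?thesis
      unfolding pbw_act_def lin_ext_def
      by (rule clinear_sum_fun cbilinear_comp_right[OF cbilinear_scaleC] *)+
  qed
  moreover have "clinear (pbw_act x)" for x
    unfolding pbw_act_def by (rule clinear_lin_ext)
  ultimately show ?thesis by (simp add: cbilinear_def)
qed

lemmas pbw_act_linear = cbilinearD[OF cbilinear_pbw_act]
  clinearD(3-5)[OF cbilinear_left[OF cbilinear_pbw_act]]
  clinearD(3-5)[OF cbilinear_right[OF cbilinear_pbw_act]]

lemma pbw_act_basis:
  assumes "i \<in> {1..N}" "set_mset M \<subseteq> {1..N}"
  shows "pbw_act (X i) (pbw_monom M) = gen_act i M"
proof -
  have "pbw_act (X i) (pbw_monom M) = (\<Sum>k=1..N. if k = i then gen_act i M else 0)"
    unfolding pbw_act_def lin_ext_single scaleC_one using assms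
    by (subst if_P, simp, intro sum.cong) (auto simp: coord_basis[OF basis assms(1)] scaleC_one)
  then show ?thesis using assms(1) by simp
qed

lemma pbw_act_low:
  assumes "v \<in> low n" "j \<in> {1..N}"
  shows "pbw_act (X j) v = lin_ext (gen_act j) v"
proof -
  have "pbw_act (X j) v = (\<Sum>K\<in>Poly_Mapping.keys v. Poly_Mapping.lookup v K *\<^sub>C pbw_act (X j) (pbw_monom K))"
    using clinear_eq_lin_ext[OF cbilinear_right[OF cbilinear_pbw_act], of "X j" v] by (simp add:
        lin_ext_def)
  also have "\<dots> = lin_ext (gen_act j) v"
    unfolding lin_ext_def using assms by (intro sum.cong) (auto simp: low_def pbw_act_basis)
  finally show ?thesis .
qed

lemma pbw_act_min:
  assumes "i \<in> {1..N}" "set_mset M \<subseteq> {1..N}" "\<forall>j\<in>#M. i \<le> j"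
  shows "pbw_act (X i) (pbw_monom M) = pbw_monom (add_mset i M)"
  using assms by (simp add: pbw_act_basis gen_act.simps[of i M])

text \<open>The recursion in its intended form, without the size test and with structure constants
collected into the bracket.\<close>

lemma pbw_act_reorder:
  assumes i: "i \<in> {1..N}" and M': "set_mset M' \<subseteq> {1..N}" and j: "j \<in> {1..N}" "\<forall>m\<in>#M'. j \<le> m" "j < i"
  shows "pbw_act (X i) (pbw_monom (add_mset j M')) = pbw_monom (add_mset i (add_mset j M'))
     + pbw_act (X j) (pbw_act (X i) (pbw_monom M') - pbw_monom (add_mset i M'))
     + pbw_act (bracket (X i) (X j)) (pbw_monom M')"
proof -
  define M where "M = add_mset j M'"
  have M: "set_mset M \<subseteq> {1..N}" using M' j by (auto simp: M_def)
  have Min: "Min_mset M = j"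
    using j(2) by (auto simp: M_def intro!: Min_eqI)
  have "M - {#j#} = M'" "\<not> (\<forall>m\<in>#M. i \<le> m)"
    using j by (auto simp: M_def not_le)
  then have g: "gen_act i M = pbw_monom (add_mset i M)
       + lin_ext (\<lambda>K. if size K < size M then gen_act j K else 0)
           (gen_act i M' - pbw_monom (add_mset i M'))
       + (\<Sum>k=1..N. struct_const N X i j k *\<^sub>C gen_act k M')"
    by (simp only: gen_act.simps[of i M] Min if_False)
  have w: "gen_act i M' - pbw_monom (add_mset i M') \<in> low (size M')"
    by (rule gen_act_leading[OF i M'])
  have "lin_ext (\<lambda>K. if size K < size M then gen_act j K else 0) (gen_act i M' - pbw_monom (add_mset i M'))
     = lin_ext (gen_act j) (gen_act i M' - pbw_monom (add_mset i M'))"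
    unfolding lin_ext_def using w by (intro sum.cong) (auto simp: low_def M_def)
  also have "\<dots> = pbw_act (X j) (pbw_act (X i) (pbw_monom M') - pbw_monom (add_mset i M'))"
    using pbw_act_low[OF w j(1)] by (simp only: pbw_act_basis[OF i M'])
  finally have 1: "lin_ext (\<lambda>K. if size K < size M then gen_act j K else 0) (gen_act i M' - pbw_monom (add_mset i M'))
     = pbw_act (X j) (pbw_act (X i) (pbw_monom M') - pbw_monom (add_mset i M'))" .
  have 2: "pbw_act (bracket (X i) (X j)) (pbw_monom M') = (\<Sum>k=1..N. struct_const N X i j k *\<^sub>C gen_act k M')"
    unfolding bracket_expansion[OF basis] clinear_sum[OF cbilinear_left[OF cbilinear_pbw_act]]
    using M' by (intro sum.cong) (auto simp: pbw_act_linear pbw_act_basis)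
  show ?thesis
    unfolding M_def[symmetric] by (simp only: pbw_act_basis[OF i M] g 1 2)
qed

definition defect :: "'g \<Rightarrow> 'g \<Rightarrow> (nat multiset \<Rightarrow>\<^sub>0 complex) \<Rightarrow> (nat multiset \<Rightarrow>\<^sub>0 complex)" where
  "defect x y v = pbw_act x (pbw_act y v) - pbw_act y (pbw_act x v) - pbw_act (bracket x y) v"

lemma defect_linear: "clinear (\<lambda>x. defect x y v)" "clinear (\<lambda>y. defect x y v)" "clinear (defect x y)"
  unfolding defect_def
  by (simp_all add: clinear_simps bracket_linear cbilinear_left[OF cbilinear_pbw_act]
      cbilinear_right[OF cbilinear_pbw_act]
    cbilinear_comp_left[OF cbilinear_pbw_act] cbilinear_comp_right[OF cbilinear_pbw_act])

lemma defect_swap: "defect x y v = - defect y x v"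
  unfolding defect_def by (subst (2) bracket_swap) (simp add: pbw_act_linear)

lemma defect_self: "defect x x v = 0"
  by (simp add: defect_def bracket_self pbw_act_linear)

lemma defect_basisI:
  assumes "\<And>i j. i \<in> {1..N} \<Longrightarrow> j \<in> {1..N} \<Longrightarrow> defect (X i) (X j) v = 0"
  shows "defect x y v = 0"
proof (rule lie_basis_linear_ext[OF basis, of "\<lambda>x. defect x y v" "\<lambda>_. 0"])
  show "defect (X i) y v = 0" if "i \<in> {1..N}" for i
    by (rule lie_basis_linear_ext[OF basis defect_linear(2) clinear_const_zero assms[OF that]])
qed (simp_all add: defect_linear clinear_const_zero)

text \<open>For \<open>j < i\<close> this is the definition of \<open>X\<^sub>i z\<^sub>j z\<^sub>M\<close>; the other case follows by antisymmetry.\<close>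

lemma defect_min:
  assumes "i \<in> {1..N}" "j \<in> {1..N}" and M: "set_mset M \<subseteq> {1..N}"
    and "(\<forall>m\<in>#M. i \<le> m) \<or> (\<forall>m\<in>#M. j \<le> m)"
  shows "defect (X i) (X j) (pbw_monom M) = 0"
proof -
  have *: "defect (X i) (X j) (pbw_monom M) = 0"
    if "i \<in> {1..N}" "j \<in> {1..N}" "j < i" "\<forall>m\<in>#M. j \<le> m" for i j
  proof -
    have "pbw_act (X j) (pbw_monom (add_mset i M)) = pbw_monom (add_mset i (add_mset j M))"
      using that M by (subst pbw_act_min) (auto simp: add_mset_commute)
    then show ?thesis
      unfolding defect_def using pbw_act_min[of j M] pbw_act_reorder[of i M j] that M by (simp
          add: pbw_act_linear)
  qed
  consider "j < i" "\<forall>m\<in>#M. j \<le> m" | "i < j" "\<forall>m\<in>#M. i \<le> m" | "i = j"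
    using assms(4) by (metis less_le_trans less_imp_le linorder_neqE_nat)
  then show ?thesis
  proof cases
    case 2
    then show ?thesis using *[OF assms(2,1)] by (subst defect_swap) simp
  qed (use * assms(1,2) defect_self in auto)
qed

text \<open>The role of the Jacobi identity in the Poincare-Birkhoff-Witt theorem. Moving \<open>e\<close> to the
left in \<open>a (b (e v))\<close> and in \<open>b (a (e v))\<close> by the assumed commutation relations, and
subtracting, leaves \<open>e ([a, b] v) + ([a, [b, e]] - [b, [a, e]]) v = e ([a, b] v) + [[a, b],
e] v = [a, b] (e v)\<close>.\<close>

lemma defect_step:
  assumes 1: "defect b e v = 0" "defect a e v = 0" "defect a b v = 0" "defect a (bracket b e) v = 0"
    "defect b (bracket a e) v = 0" "defect (bracket a b) e v = 0"
    and 2: "defect a e (pbw_act b v) = 0" "defect b e (pbw_act a v) = 0"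
  shows "defect a b (pbw_act e v) = 0"
proof -
  note E = assms[unfolded defect_def, unfolded diff_diff_eq right_minus_eq]
  have J: "bracket a (bracket b e) = bracket b (bracket a e) + bracket (bracket a b) e"
  proof -
    have "bracket b (bracket e a) = - bracket b (bracket a e)"
      by (subst (2) bracket_swap) (simp add: clinearD(4)[OF bracket_linear(2)])
    moreover have "bracket e (bracket a b) = - bracket (bracket a b) e"
      by (rule bracket_swap)
    ultimately have "bracket a (bracket b e) - (bracket b (bracket a e) + bracket (bracket a b) e) = 0"
      using jacobi[of a b e] by (simp only: diff_conv_add_uminus minus_add_distrib add.assoc)
    then show ?thesis by (simp only: right_minus_eq)
  qed
  show ?thesis
    unfolding defect_def using E by (simp add: pbw_act_linear J algebra_simps)
qed

text \<open>Induction on the degree. If neither \<open>i\<close> nor \<open>j\<close> is minimal for \<open>M\<close>, split off the minimal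
index, \<open>z\<^sub>M = X\<^sub>k z\<^sub>M'\<close>, and apply \<open>defect_step\<close> with \<open>e = X\<^sub>k\<close>. Its last two premises
concern polynomials of the same degree as \<open>z\<^sub>M\<close>, but their leading monomials are handled by
minimality of \<open>k\<close>, and the remainder has smaller degree.\<close>

lemma defect_low:
  assumes "v \<in> low n"
  shows "defect x y v = 0"
  using assms
proof (induction n arbitrary: v x y rule: less_induct)
  case (less n)
  have monom: "defect x y (pbw_monom M) = 0" if M: "size M \<le> n" "set_mset M \<subseteq> {1..N}" for M x y
  proof (rule defect_basisI)
    fix i j assume ij: "i \<in> {1..N}" "j \<in> {1..N}"
    show "defect (X i) (X j) (pbw_monom M) = 0"
    proof (cases "(\<forall>m\<in>#M. i \<le> m) \<or> (\<forall>m\<in>#M. j \<le> m)")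
      case True
      then show ?thesis using defect_min ij M by blast
    next
      case False
      define k M' where "k = Min_mset M" and "M' = M - {#k#}"
      have "k \<in># M" using False by (auto simp: k_def intro: Min_mset_in)
      then have MM: "M = add_mset k M'" and k: "k \<in> {1..N}" and M': "set_mset M' \<subseteq> {1..N}"
        using M(2) by (auto simp: M'_def dest: in_diffD)
      have kM': "\<forall>m\<in>#M'. k \<le> m"
        using Min_le[of "set_mset M"] unfolding k_def M'_def by (auto dest: in_diffD)
      have s: "size M' < n" using M(1) MM by simp
      note IH = less.IH[OF s]
      have v: "pbw_monom M' \<in> low (size M')" using M' by (simp add: pbw_monom_low)
      \<comment> \<open>Leading monomial by minimality of \<open>k\<close>, remainder by the induction hypothesis.\<close>
      have top: "defect (X i) (X k) (pbw_act (X j) (pbw_monom M')) = 0" if ij: "i \<in> {1..N}"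
          "j \<in> {1..N}" "k \<le> j" for i j
      proof -
        have "defect (X i) (X k) (pbw_act (X j) (pbw_monom M') - pbw_monom (add_mset j M')) = 0"
          using gen_act_leading[of j M'] ij M' by (intro IH) (simp add: pbw_act_basis)
        moreover have "defect (X i) (X k) (pbw_monom (add_mset j M')) = 0"
          by (rule defect_min) (use ij k M' kM' in auto)
        ultimately show ?thesis by (simp add: clinearD[OF defect_linear(3)])
      qed
      have "k \<le> i" "k \<le> j"
        using False kM' unfolding MM by (auto simp: not_le)
      then have "defect (X i) (X j) (pbw_act (X k) (pbw_monom M')) = 0"
        by - (rule defect_step, (rule IH[OF v] top ij | assumption)+)
      then show ?thesis
        by (simp only: pbw_act_min[OF k M' kM'] MM)
    qed
  qed
  have "defect x y v = (\<Sum>M\<in>Poly_Mapping.keys v. Poly_Mapping.lookup v M *\<^sub>C defect x y (pbw_monom M))"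
    by (rule clinear_eq_lin_ext[OF defect_linear(3), unfolded lin_ext_def])
  also have "\<dots> = 0"
    using less.prems by (intro sum.neutral) (auto simp: low_def monom)
  finally show ?case .
qed

lemma lie_action_pbw_act: "lie_action pbw_act"
  unfolding lie_action_def
proof (intro conjI allI cbilinear_pbw_act)
  fix x y v
  have "defect x y v = 0"
  proof (rule clinear_eqI[OF defect_linear(3) clinear_const_zero])
    fix M
    show "defect x y (pbw_monom M) = 0"
    proof (cases "set_mset M \<subseteq> {1..N}")
      case True
      then show ?thesis by (intro defect_low[of _ "size M"] pbw_monom_low) auto
    next
      case False
      then have "pbw_act x (pbw_monom M) = 0" for x
        by (simp only: pbw_act_def lin_ext_single if_False cvec.scale_zero_right)
      then show ?thesis by (simp add: defect_def pbw_act_linear)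
    qed
  qed
  then show "pbw_act (bracket x y) v = pbw_act x (pbw_act y v) - pbw_act y (pbw_act x v)"
    by (simp add: defect_def)
qed

text \<open>Apply \<open>u\<close> to the constant polynomial \<open>1\<close> and read off the linear part.\<close>

definition uea_proj :: "'g uea \<Rightarrow> 'g" where
  "uea_proj u = (\<Sum>k=1..N. Poly_Mapping.lookup (uea_action pbw_act u (pbw_monom {#})) {#k#} *\<^sub>C X k)"

lemma clinear_uea_proj: "clinear uea_proj"
  unfolding uea_proj_def
  by (rule clinearI) (simp_all add: cbilinearD[OF uea_action(1)[OF lie_action_pbw_act]]
      lookup_add lookup_scaleC
    scaleC_add_left sum.distrib cvec.scale_sum_right scaleC_complex_def scaleC_scaleC)

lemma uea_proj_incl: "uea_proj (\<iota> x) = x"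
proof -
  have "clinear (\<lambda>x. uea_proj (\<iota> x))"
    by (rule clinear_compose[OF clinear_uea_proj]) (rule clinearI, simp_all add: uea_incl_linear)
  then show ?thesis
  proof (rule lie_basis_linear_ext[OF basis _ clinear_ident])
    fix i assume i: "i \<in> {1..N}"
    have "pbw_act (X i) (pbw_monom {#}) = pbw_monom {#i#}"
      by (rule pbw_act_min[OF i]) auto
    then have "uea_proj (\<iota> (X i)) = (\<Sum>k=1..N. if k = i then X i else 0)"
      unfolding uea_proj_def uea_action[OF lie_action_pbw_act]
      by (simp only:, intro sum.cong) (auto simp: lookup_single when_def scaleC_one)
    then show "uea_proj (\<iota> (X i)) = X i" using i by simp
  qed
qed

end

section \<open>Primitive elements of the enveloping algebra\<close>

text \<open>Everything is phrased by spans of products of generators, without a basis of \<open>U\<close>; that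
products of different length may be linearly dependent is harmless.\<close>

abbreviation uea_word :: "'g::lie_algebra list \<Rightarrow> 'g uea" where
  "uea_word w \<equiv> prod_list (map \<iota> w)"

definition uea_filt :: "nat \<Rightarrow> 'g::lie_algebra uea set" where
  "uea_filt n = cvec.span {uea_word w | w. length w \<le> n}"

lemma uea_word_in_filt: "length w \<le> n \<Longrightarrow> uea_word w \<in> uea_filt n"
  unfolding uea_filt_def by (rule cvec.span_base) auto

lemma uea_filt_mono: "u \<in> uea_filt m \<Longrightarrow> m \<le> n \<Longrightarrow> u \<in> uea_filt n"
  unfolding uea_filt_def
  by (erule subsetD[OF cvec.span_mono, rotated]) (use le_trans in blast)

lemma subspace_uea_filt: "cvec.subspace (uea_filt n)"
  unfolding uea_filt_def by (rule cvec.subspace_span)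

lemmas uea_filt_closed = cvec.subspace_add[OF subspace_uea_filt] cvec.subspace_diff[OF subspace_uea_filt]
  cvec.subspace_scale[OF subspace_uea_filt] cvec.subspace_0[OF subspace_uea_filt]

lemma clinear_maps_span:
  assumes "clinear f" "cvec.subspace V" "\<And>r. r \<in> R \<Longrightarrow> f r \<in> V" "p \<in> cvec.span R"
  shows "f p \<in> V"
  using assms(4)
proof (induction rule: cvec.span_induct)
  case base
  show ?case
    using assms(2) by (auto intro!: cvec.subspaceI simp: clinearD[OF assms(1)]
      cvec.subspace_0 cvec.subspace_add cvec.subspace_scale)
qed (rule assms(3))

lemma uea_filt_mult_left:
  fixes u :: "'g::lie_algebra uea"
  assumes "u \<in> uea_filt n"
  shows "\<iota> x * u \<in> uea_filt (Suc n)"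
proof (rule clinear_maps_span[OF _ subspace_uea_filt _ assms[unfolded uea_filt_def]])
  fix r :: "'g uea" assume "r \<in> {uea_word w |w. length w \<le> n}"
  then obtain w where "r = uea_word w" "length w \<le> n" by blast
  then show "\<iota> x * r \<in> uea_filt (Suc n)"
    using uea_word_in_filt[of "x # w"] by simp
qed (simp add: clinear_simps)

lemma uea_filt_mult_word:
  fixes u :: "'g::lie_algebra uea"
  assumes "u \<in> uea_filt n"
  shows "u * uea_word v \<in> uea_filt (n + length v)"
proof (rule clinear_maps_span[OF _ subspace_uea_filt _ assms[unfolded uea_filt_def]])
  fix r :: "'g uea" assume "r \<in> {uea_word w |w. length w \<le> n}"
  then obtain w where "r = uea_word w" "length w \<le> n" by blast
  then show "r * uea_word v \<in> uea_filt (n + length v)"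
    using uea_word_in_filt[of "w @ v"] by simp
qed (simp add: clinear_simps)

text \<open>A generator commutes with a word up to words of the same length as the given one, because
every interchange replaces two letters by their bracket.\<close>

lemma uea_word_commutator: "\<iota> x * uea_word v - uea_word v * \<iota> x \<in> uea_filt (length v)"
proof (induction v)
  case (Cons y v)
  have "\<iota> x * uea_word (y # v) - uea_word (y # v) * \<iota> x
      = uea_word (bracket x y # v) + \<iota> y * (\<iota> x * uea_word v - uea_word v * \<iota> x)"
    by (simp add: uea_incl_bracket left_diff_distrib right_diff_distrib mult.assoc)
  also have "\<dots> \<in> uea_filt (length (y # v))"
    using uea_filt_mult_left[OF Cons.IH, of y] by (intro uea_filt_closed(1) uea_word_in_filt)
        simp_all
  finally show ?case .
qed (simp add: uea_filt_closed)

text \<open>The map \<open>u \<mapsto> u\<^sub>1 v u\<^sub>2\<close>. For \<open>v = 1\<close> this is \<open>\<Psi>\<close>; general \<open>v\<close> make the recursion over \<open>u\<close>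
closed, since the second summand of \<open>\<Delta> x\<close> puts the letter \<open>x\<close> next to \<open>v\<close>.\<close>

definition comul_insert :: "'g::lie_algebra uea \<Rightarrow> 'g uea \<Rightarrow> 'g uea" where
  "comul_insert v u = sweedler (uea_comul u) (\<lambda>p q. p * (v * q))"

lemma clinear_comul_insert: "clinear (comul_insert v)"
  unfolding comul_insert_def by (simp add: clinear_simps uea_clinear_simps)

lemma comul_insert_one: "comul_insert v 1 = v"
  unfolding comul_insert_def by (simp add: uea_comul_one sweedler_pure clinear_simps)

lemma comul_insert_step: "comul_insert v (\<iota> x * u) = \<iota> x * comul_insert v u + comul_insert (v * \<iota> x) u"
  unfolding comul_insert_def by (simp add: uea_comul_step sweedler_simps clinear_simps mult.assoc)

text \<open>Comultiplying distributes the \<open>n\<close> letters of \<open>w\<close> to the two sides of \<open>v\<close> in \<open>2\<^sup>n\<close> ways, and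
modulo shorter words the order of letters is irrelevant.\<close>

lemma comul_insert_leading:
  "length v + length w \<le> Suc n \<Longrightarrow>
    comul_insert (uea_word v) (uea_word w) - 2 ^ length w *\<^sub>C (uea_word v * uea_word w) \<in> uea_filt n"
proof (induction w arbitrary: v n)
  case Nil
  then show ?case by (simp add: comul_insert_one scaleC_one uea_filt_closed)
next
  case (Cons x w)
  let ?P = "uea_word v" and ?Q = "uea_word w" and ?c = "2 ^ length w :: complex"
  have 1: "\<iota> x * (comul_insert ?P ?Q - ?c *\<^sub>C (?P * ?Q)) \<in> uea_filt n"
  proof (cases n)
    case 0
    then show ?thesis using Cons.prems by (simp add: comul_insert_one scaleC_one uea_filt_closed)
  next
    case (Suc m)
    have "comul_insert ?P ?Q - ?c *\<^sub>C (?P * ?Q) \<in> uea_filt m"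
      by (rule Cons.IH) (use Cons.prems Suc in simp)
    then show ?thesis
      unfolding Suc by (rule uea_filt_mult_left)
  qed
  have 2: "comul_insert (?P * \<iota> x) ?Q - ?c *\<^sub>C (?P * \<iota> x * ?Q) \<in> uea_filt n"
    using Cons.IH[of "v @ [x]" n] Cons.prems by simp
  have 3: "?c *\<^sub>C ((\<iota> x * ?P - ?P * \<iota> x) * ?Q) \<in> uea_filt n"
    by (rule uea_filt_closed(3), rule uea_filt_mono[OF uea_filt_mult_word[OF uea_word_commutator]])
      (use Cons.prems in simp)
  have two: "(2::complex) ^ length (x # w) = ?c + ?c" by simp
  have "comul_insert ?P (uea_word (x # w)) - 2 ^ length (x # w) *\<^sub>C (?P * uea_word (x # w))
     = \<iota> x * (comul_insert ?P ?Q - ?c *\<^sub>C (?P * ?Q)) + (comul_insert (?P * \<iota> x) ?Q - ?c *\<^sub>C (?P * \<iota> x * ?Q))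
       + ?c *\<^sub>C ((\<iota> x * ?P - ?P * \<iota> x) * ?Q)"
    by (simp only: list.map prod_list.Cons two comul_insert_step left_diff_distrib
        right_diff_distrib
        mult_scaleC_right cvec.scale_right_diff_distrib scaleC_add_left mult.assoc)
       (simp add: algebra_simps)
  then show ?case
    using uea_filt_closed(1)[OF uea_filt_closed(1)[OF 1 2] 3] by (simp only:)
qed

definition tensor_filt :: "nat \<Rightarrow> ('g::lie_algebra uea \<otimes> 'f::complex_vector) set" where
  "tensor_filt n = cvec.span {uea_word w \<otimes> f | w f. length w \<le> n}"

lemma subspace_tensor_filt: "cvec.subspace (tensor_filt n)"
  unfolding tensor_filt_def by (rule cvec.subspace_span)

lemmas tensor_filt_closed = cvec.subspace_add[OF subspace_tensor_filt] cvec.subspace_diff[OF subspace_tensor_filt]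
  cvec.subspace_scale[OF subspace_tensor_filt] cvec.subspace_0[OF subspace_tensor_filt]

lemma tensor_filt_mono: "t \<in> tensor_filt m \<Longrightarrow> m \<le> n \<Longrightarrow> t \<in> tensor_filt n"
  unfolding tensor_filt_def
  by (erule subsetD[OF cvec.span_mono, rotated]) (use le_trans in blast)

lemma pure_tensor_filt: "u \<in> uea_filt n \<Longrightarrow> u \<otimes> f \<in> tensor_filt n"
  by (rule clinear_maps_span[OF cbilinear_left[OF cbilinear_pure] subspace_tensor_filt, where R
      = "{uea_word w | w. length w \<le> n}"])
    (auto simp: uea_filt_def tensor_filt_def intro: cvec.span_base)

text \<open>A tensor is a finite sum of pure tensors, each of which lies in some step of the filtration.\<close>

lemma tensor_filt_exhausts: obtains n where "t \<in> tensor_filt n"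
proof -
  have U: "\<exists>n. u \<in> uea_filt n" for u :: "'a uea"
  proof -
    obtain p where p: "u = abs_uea p" by (rule abs_uea_surj)
    have "u = (\<Sum>k\<in>Poly_Mapping.keys p. Poly_Mapping.lookup p k *\<^sub>C uea_word (letters k))"
      unfolding p clinear_eq_lin_ext[OF clinear_abs_uea, of p] lin_ext_def
      by (simp add: uea_word_abs)
    also have "\<dots> \<in> uea_filt (Max (insert 0 ((\<lambda>k. length (letters k)) ` Poly_Mapping.keys p)))"
      by (intro cvec.subspace_sum[OF subspace_uea_filt] uea_filt_closed(3) uea_word_in_filt)
          (auto intro!: Max_ge)
    finally show ?thesis by blast
  qed
  have "\<exists>n. sum f A \<in> tensor_filt n" if "finite A" "\<And>k. k \<in> A \<Longrightarrow> \<exists>n. f k \<in> tensor_filt n" for f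
      :: "'c \<Rightarrow> 'a uea \<otimes> 'b" and A
    using that
  proof (induction A rule: finite_induct)
    case (insert k A)
    then obtain m n where "f k \<in> tensor_filt m" "sum f A \<in> tensor_filt n" by blast
    then have "f k + sum f A \<in> tensor_filt (max m n)"
      by (intro tensor_filt_closed) (auto intro: tensor_filt_mono)
    then show ?case using insert by auto
  qed (auto intro: tensor_filt_closed)
  note S = this
  have "\<exists>n. sweedler t (\<otimes>) \<in> tensor_filt n"
    unfolding sweedler_def lin_ext_def
    by (rule S) (use U pure_tensor_filt in \<open>force simp: case_prod_beta intro: tensor_filt_closed\<close>)+
  then show thesis using that by (auto simp: sweedler_pure_id)
qed

text \<open>The map \<open>\<Psi> \<otimes> id\<close>.\<close>

definition doubling :: "'g::lie_algebra uea \<otimes> 'f::complex_vector \<Rightarrow> 'g uea \<otimes> 'f" where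
  "doubling t = sweedler t (\<lambda>u f. comul_insert 1 u \<otimes> f)"

lemmas insert_clinear_simps = clinear_comul_insert clinear_compose[OF clinear_comul_insert]

lemma clinear_doubling: "clinear doubling"
  unfolding doubling_def by (simp add: clinear_simps insert_clinear_simps)

lemma doubling_pure: "doubling (u \<otimes> f) = comul_insert 1 u \<otimes> f"
  unfolding doubling_def by (simp add: sweedler_pure clinear_simps insert_clinear_simps)

lemma doubling_leading:
  assumes "t \<in> tensor_filt (Suc n)"
  shows "doubling t - 2 ^ Suc n *\<^sub>C t \<in> tensor_filt n"
proof (rule clinear_maps_span[OF _ subspace_tensor_filt _ assms[unfolded tensor_filt_def]])
  show "clinear (\<lambda>t. doubling t - 2 ^ Suc n *\<^sub>C t)"
    by (simp add: clinear_simps clinear_doubling)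
  fix r :: "'a uea \<otimes> 'b" assume "r \<in> {uea_word w \<otimes> f |w f. length w \<le> Suc n}"
  then obtain w f where r: "r = uea_word w \<otimes> f" and w: "length w \<le> Suc n" by blast
  have "comul_insert 1 (uea_word w) - 2 ^ length w *\<^sub>C uea_word w \<in> uea_filt n"
    using comul_insert_leading[of "[]" w n] w by simp
  moreover have "(2 ^ length w - 2 ^ Suc n) *\<^sub>C uea_word w \<in> uea_filt n"
  proof (cases "length w = Suc n")
    case True
    then show ?thesis by (simp add: uea_filt_closed)
  next
    case False
    then show ?thesis using w by (intro uea_filt_closed uea_word_in_filt) simp
  qed
  ultimately have "comul_insert 1 (uea_word w) - 2 ^ length w *\<^sub>C uea_word w
     + (2 ^ length w - 2 ^ Suc n) *\<^sub>C uea_word w \<in> uea_filt n"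
    by (rule uea_filt_closed)
  then have "comul_insert 1 (uea_word w) - 2 ^ Suc n *\<^sub>C uea_word w \<in> uea_filt n"
    by (simp only: cvec.scale_left_diff_distrib diff_add_cancel add_diff_eq)
  from pure_tensor_filt[OF this, of f] show "doubling r - 2 ^ Suc n *\<^sub>C r \<in> tensor_filt n"
    by (simp only: r doubling_pure clinearD(5)[OF cbilinear_left[OF cbilinear_pure]]
        pure_tensor_linear)
qed

text \<open>On the eigenvector \<open>t\<close>, subtracting \<open>2\<^sup>n\<^sup>+\<^sup>1\<close> times the identity from \<open>\<Psi> \<otimes> id\<close> multiplies it
by \<open>2 - 2\<^sup>n\<^sup>+\<^sup>1\<close>, which is nonzero unless \<open>n = 0\<close>. So \<open>doubling_leading\<close> lowers the
filtration degree until it is one.\<close>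

lemma doubling_eigen_filt_one:
  assumes "doubling t = 2 *\<^sub>C t"
  shows "t \<in> tensor_filt 1"
proof -
  obtain n where "t \<in> tensor_filt n" by (rule tensor_filt_exhausts)
  then show ?thesis
  proof (induction n)
    case (Suc n)
    show ?case
    proof (cases n)
      case 0
      then show ?thesis using Suc.prems by simp
    next
      case (Suc m)
      define c where "c = (2 - 2 ^ Suc n :: complex)"
      have "(2::complex) ^ n \<noteq> 1"
      proof
        assume "(2::complex) ^ n = 1"
        then have "norm ((2::complex) ^ n) = 1" by simp
        then have "(2::real) ^ n = 1" by (simp add: norm_power)
        moreover have "1 < (2::real) ^ n"
          using Suc by (intro one_less_power) auto
        ultimately show False by linarith
      qed
      then have c: "c \<noteq> 0" by (simp add: c_def)
      have "c *\<^sub>C t \<in> tensor_filt n"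
        using doubling_leading[OF Suc.prems] by (simp only: assms c_def
            cvec.scale_left_diff_distrib)
      then have "inverse c *\<^sub>C c *\<^sub>C t \<in> tensor_filt n"
        by (rule tensor_filt_closed)
      then have "t \<in> tensor_filt n"
        using c by (simp add: scaleC_scaleC scaleC_one)
      then show ?thesis by (rule Suc.IH)
    qed
  qed (auto intro: tensor_filt_mono)
qed

text \<open>Primitive elements of \<open>U\<close> come from \<open>\<gg>\<close>, with coefficients in an arbitrary vector space.
Words of length at most one leave \<open>t = 1 \<otimes> g + s\<close> with \<open>s\<close> from \<open>\<gg> \<otimes> \<F>\<close>, and \<open>1 \<otimes> g\<close>
vanishes because it has eigenvalue 1 instead of 2.\<close>

lemma doubling_eigen:
  fixes t :: "'g::lie_algebra uea \<otimes> 'f::complex_vector"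
  assumes "doubling t = 2 *\<^sub>C t"
  shows "\<exists>s :: 'g \<otimes> 'f. t = sweedler s (\<lambda>y f. \<iota> y \<otimes> f)"
proof -
  let ?j = "\<lambda>s :: 'g \<otimes> 'f. sweedler s (\<lambda>y f. \<iota> y \<otimes> f)"
  have j: "clinear ?j" and jp: "?j (y \<otimes> f) = \<iota> y \<otimes> f" for y f
    by (simp_all add: clinear_simps uea_clinear_simps sweedler_pure)
  have "\<exists>g s. t = 1 \<otimes> g + ?j s"
    using doubling_eigen_filt_one[OF assms] unfolding tensor_filt_def
  proof (induction rule: cvec.span_induct_alt)
    case base
    have "0 = 1 \<otimes> 0 + ?j 0" by (simp only: clinearD[OF j] pure_zero add_0)
    then show ?case by blast
  next
    case (step c x y)
    then obtain g s where y: "y = 1 \<otimes> g + ?j s" by blast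
    from step(1) obtain w f where x: "x = uea_word w \<otimes> f" and w: "length w \<le> 1" by blast
    consider "w = []" | z where "w = [z]"
      using w by (cases w) auto
    then show ?case
    proof cases
      case 1
      then have "c *\<^sub>C x + y = 1 \<otimes> (c *\<^sub>C f + g) + ?j s"
        by (simp add: x y pure_tensor_linear)
      then show ?thesis by blast
    next
      case 2
      then have "c *\<^sub>C x + y = 1 \<otimes> g + ?j (c *\<^sub>C (z \<otimes> f) + s)"
        by (simp add: x y clinearD[OF j] jp)
      then show ?thesis by blast
    qed
  qed
  then obtain g s where t: "t = 1 \<otimes> g + ?j s" by blast
  have "doubling (?j s) = ?j s + ?j s"
  proof -
    have "comul_insert 1 (\<iota> y) = \<iota> y + \<iota> y" for y :: 'g
      using comul_insert_step[of 1 y 1] by (simp add: comul_insert_one)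
    then show ?thesis
      by (simp add: sweedler_linear[OF clinear_doubling] doubling_pure pure_tensor_linear
          sweedler_plus)
  qed
  then have "doubling t = 1 \<otimes> g + (?j s + ?j s)"
    by (simp add: t clinearD[OF clinear_doubling] doubling_pure comul_insert_one)
  moreover have "doubling t = t + t"
    using assms scaleC_add_left[of 1 1 t] by (simp add: scaleC_one)
  ultimately have "(1 :: 'g uea) \<otimes> g = 0"
    by (simp add: t algebra_simps)
  then show ?thesis using t by auto
qed

section \<open>From a matched pair to a \<open>\<gg>\<close>-Hopf algebra\<close>

locale uea_matched_pair = finite_lie_basis N X +
  matched_pair \<Delta> \<epsilon> S uea_comul uea_counit uea_antipode act \<rho>
  for N and X :: "nat \<Rightarrow> 'g::lie_algebra"
    and \<Delta> :: "'f::{complex_algebra_1, comm_ring_1} \<Rightarrow> 'f \<otimes> 'f" and \<epsilon> S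
    and act :: "'g uea \<Rightarrow> 'f \<Rightarrow> 'f" and \<rho>
begin

lemma clinear_coaction: "clinear \<rho>"
  using comodule by (simp add: right_comodule_def)

lemmas pair_clinear_simps = clinear_simps uea_clinear_simps clinear_coaction clinear_compose[OF clinear_coaction]
  cbilinear_left[OF cbilinear_act] cbilinear_right[OF cbilinear_act]
  cbilinear_comp_left[OF cbilinear_act] cbilinear_comp_right[OF cbilinear_act]
  clinear_uea_proj clinear_compose[OF clinear_uea_proj]

text \<open>Here \<open>\<rho>\<close> is the coaction on all of \<open>U\<close>. Its restriction to \<open>\<gg>\<close> is defined through the left
inverse of \<open>\<iota>\<close>, hence linear by construction; that it does restrict \<open>\<rho>\<close> is \<open>coaction_incl\<close>.\<close>

definition coact :: "'g \<Rightarrow> 'g \<otimes> 'f" where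
  "coact x = sweedler (\<rho> (\<iota> x)) (\<lambda>u f. uea_proj u \<otimes> f)"

lemma clinear_coact: "clinear coact"
  unfolding coact_def by (simp add: pair_clinear_simps)

text \<open>Multiply the first two legs in the comodule coalgebra axiom at \<open>u = \<iota> x\<close>.\<close>

lemma doubling_coaction: "doubling (\<rho> (\<iota> x)) = 2 *\<^sub>C \<rho> (\<iota> x)"
proof -
  have "sweedler (\<rho> (\<iota> x)) (\<lambda>v f. sweedler (uea_comul v) (\<lambda>v\<^sub>1 v\<^sub>2. v\<^sub>1 \<otimes> v\<^sub>2 \<otimes> f))
     = sweedler (\<rho> (\<iota> x)) (\<lambda>v f. v \<otimes> 1 \<otimes> f) + sweedler (\<rho> (\<iota> x)) (\<lambda>v f. 1 \<otimes> v \<otimes> f)"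
    by (simp add: comodule_coalgebra_comul uea_comul(2) coaction_one sweedler_simps
        pair_clinear_simps)
  from arg_cong[OF this, of "\<lambda>t. sweedler t (\<lambda>a t. sweedler t (\<lambda>b f. (a * b) \<otimes> f))"]
  have "doubling (\<rho> (\<iota> x)) = \<rho> (\<iota> x) + \<rho> (\<iota> x)"
    by (simp add: doubling_def comul_insert_def sweedler_simps pair_clinear_simps sweedler_pure_id)
  then show ?thesis
    using scaleC_add_left[of 1 1 "\<rho> (\<iota> x)"] by (simp add: scaleC_one)
qed

lemma sweedler_incl_proj:
  "sweedler (sweedler s (\<lambda>y f. \<iota> y \<otimes> f)) (\<lambda>u f. uea_proj u \<otimes> f) = s"
  by (simp add: sweedler_simps pair_clinear_simps uea_proj_incl sweedler_pure_id)

lemma coaction_incl: "\<rho> (\<iota> x) = sweedler (coact x) (\<lambda>y f. \<iota> y \<otimes> f)"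
proof -
  obtain s where s: "\<rho> (\<iota> x) = sweedler s (\<lambda>y f. \<iota> y \<otimes> f)"
    using doubling_eigen[OF doubling_coaction] by blast
  have "coact x = s"
    unfolding coact_def s by (rule sweedler_incl_proj)
  then show ?thesis using s by simp
qed

lemma restricts_to_coact: "restricts_to \<rho> coact"
  by (simp add: restricts_to_def coaction_incl)

lemma right_comodule_coact: "right_comodule \<Delta> \<epsilon> coact"
  unfolding right_comodule_def
proof (intro conjI allI clinear_coact)
  note L = F.clinear_comul clinear_compose[OF F.clinear_comul] F.clinear_counit
      clinear_compose[OF F.clinear_counit]
    clinear_coact clinear_compose[OF clinear_coact]
  fix x
  have "sweedler (\<rho> (\<iota> x)) (\<lambda>w f. sweedler (\<rho> w) (\<lambda>x g. x \<otimes> g \<otimes> f))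
        = sweedler (\<rho> (\<iota> x)) (\<lambda>w f. sweedler (\<Delta> f) (\<lambda>g h. w \<otimes> g \<otimes> h))"
    using comodule by (simp add: right_comodule_def)
  from arg_cong[OF this, of "\<lambda>t. sweedler t (\<lambda>u s. uea_proj u \<otimes> s)"]
  show "sweedler (coact x) (\<lambda>w f. sweedler (coact w) (\<lambda>x g. x \<otimes> g \<otimes> f))
        = sweedler (coact x) (\<lambda>w f. sweedler (\<Delta> f) (\<lambda>g h. w \<otimes> g \<otimes> h))"
    by (simp add: coaction_incl sweedler_simps pair_clinear_simps L uea_proj_incl)
  have "sweedler (\<rho> (\<iota> x)) (\<lambda>w f. \<epsilon> f *\<^sub>C w) = \<iota> x"
    using comodule by (simp add: right_comodule_def)
  from arg_cong[OF this, of uea_proj]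
  show "sweedler (coact x) (\<lambda>w f. \<epsilon> f *\<^sub>C w) = x"
    by (simp add: coaction_incl sweedler_simps pair_clinear_simps L uea_proj_incl
        sweedler_linear[OF clinear_uea_proj] clinearD[OF clinear_uea_proj])
qed

abbreviation lact :: "'g \<Rightarrow> 'f \<Rightarrow> 'f" where "lact \<equiv> \<lambda>x f. act (\<iota> x) f"

text \<open>Compare \<open>\<nabla>\<close> at both sides of \<open>\<iota> [x, y] = \<iota> x \<iota> y - \<iota> y \<iota> x\<close>, using the product rule on the
right. The quadratic terms form a commutator in \<open>U\<close> because \<open>\<F>\<close> is commutative.\<close>

lemma coact_bracket: "coact (bracket x y) = lie_structure lact coact x y"
proof -
  have m: "\<rho> (\<iota> x * \<iota> y) = sweedler (coact x) (\<lambda>a f. sweedler (coact y) (\<lambda>b g. (\<iota> a * \<iota> b) \<otimes> (f * g)))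
     + sweedler (coact y) (\<lambda>b g. \<iota> b \<otimes> lact x g)" for x y
    by (simp add: coaction_mult uea_comul(2) coaction_incl coaction_one act_one sweedler_simps
        pair_clinear_simps)
  have "sweedler (coact (bracket x y)) (\<lambda>y f. \<iota> y \<otimes> f) = \<rho> (\<iota> x * \<iota> y) - \<rho> (\<iota> y * \<iota> x)"
    by (simp add: clinearD[OF clinear_coaction] uea_incl_bracket flip: coaction_incl)
  also have "\<dots> = sweedler (lie_structure lact coact x y) (\<lambda>y f. \<iota> y \<otimes> f)"
    unfolding m lie_structure_def
    by (simp add: sweedler_simps sweedler_diff_simps uea_incl_bracket pair_clinear_simps
        sweedler_swap[of "coact y" "coact x"] mult.commute)
  finally show ?thesis
    using sweedler_incl_proj by metis
qed

theorem g_hopf_algebra_restriction: "g_hopf_algebra \<Delta> \<epsilon> S N X lact coact"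
proof (intro g_hopf_algebra.intro g_hopf_algebra_axioms.intro)
  show "hopf_algebra \<Delta> \<epsilon> S" ..
  have B: "cbilinear lact" by (simp add: pair_clinear_simps)
  note A = cbilinearD[OF cbilinear_act] clinearD(5)[OF cbilinear_left[OF cbilinear_act]]
  show "lie_action lact"
    using B by (simp add: lie_action_def uea_incl_bracket A act_mult)
  show "lact x (f * g) = lact x f * g + f * lact x g" for x f g
    by (simp add: module_algebra_mult uea_comul(2) sweedler_simps pair_clinear_simps act_one)
  show "\<exists>f. (\<forall>j\<in>{1..N}. coact (X j) = (\<Sum>i=1..N. X i \<otimes> f i j)) \<and>
      (\<forall>i\<in>{1..N}. \<forall>j\<in>{1..N}. \<forall>k\<in>{1..N}.
         lact (X i) (f k j) - lact (X j) (f k i) =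
           (\<Sum>s=1..N. \<Sum>r=1..N. struct_const N X s r k *\<^sub>C (f r i * f s j))
         + (\<Sum>l=1..N. struct_const N X i j l *\<^sub>C f k l))"
  proof (intro exI conjI)
    define f where "f i j = sweedler (coact (X j)) (\<lambda>y f. coord N X i y *\<^sub>C f)" for i j
    have f: "coact (X j) = (\<Sum>i=1..N. X i \<otimes> f i j)" for j
      unfolding f_def by (rule tensor_expansion[OF basis])
    then show "\<forall>j\<in>{1..N}. coact (X j) = (\<Sum>i=1..N. X i \<otimes> f i j)" by blast
    show "\<forall>i\<in>{1..N}. \<forall>j\<in>{1..N}. \<forall>k\<in>{1..N}.
         lact (X i) (f k j) - lact (X j) (f k i) =
           (\<Sum>s=1..N. \<Sum>r=1..N. struct_const N X s r k *\<^sub>C (f r i * f s j))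
         + (\<Sum>l=1..N. struct_const N X i j l *\<^sub>C f k l)"
      using structure_identity_iff[OF basis clinear_coact B f] coact_bracket by blast
  qed
  show "\<Delta> (lact x f) = bullet lact coact x (\<Delta> f)" for x f
    by (simp add: comul_act bullet_def uea_comul(2) coaction_incl coaction_one act_one
        sweedler_simps pair_clinear_simps
      F.clinear_comul sweedler_swap[of "coact x"])
  show "\<epsilon> (lact x f) = 0" for x f
    by (simp add: counit_act uea_counit)
qed (rule basis right_comodule_coact)+

end

section \<open>The correspondence\<close>

theorem theorem3p2p6:
  fixes N :: nat
    and X :: "nat \<Rightarrow> 'g::lie_algebra"
    and \<Delta> :: "'f::{complex_algebra_1, comm_ring_1} \<Rightarrow> 'f \<otimes> 'f"
    and \<epsilon> :: "'f \<Rightarrow> complex"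
    and S :: "'f \<Rightarrow> 'f"
  assumes "lie_basis N X"
  shows
    "(\<forall>act \<rho>\<^sub>g. g_hopf_algebra \<Delta> \<epsilon> S N X act \<rho>\<^sub>g \<longrightarrow>
        (\<exists>!\<rho>. extended_coaction act \<rho>\<^sub>g \<rho>) \<and>
        matched_pair \<Delta> \<epsilon> S uea_comul uea_counit uea_antipode
          (uea_action act) (uea_coaction act \<rho>\<^sub>g)) \<and>
     (\<forall>act \<rho>. matched_pair \<Delta> \<epsilon> S
          (uea_comul :: 'g uea \<Rightarrow> 'g uea \<otimes> 'g uea) uea_counit uea_antipode act \<rho> \<longrightarrow>
        (\<exists>\<rho>\<^sub>g. restricts_to \<rho> \<rho>\<^sub>g \<and>
           g_hopf_algebra \<Delta> \<epsilon> S N X (\<lambda>x f. act (\<iota> x) f) \<rho>\<^sub>g))"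
proof (intro conjI allI impI)
  fix act :: "'g \<Rightarrow> 'f \<Rightarrow> 'f" and \<rho>\<^sub>g
  assume "g_hopf_algebra \<Delta> \<epsilon> S N X act \<rho>\<^sub>g"
  then interpret g_hopf_algebra \<Delta> \<epsilon> S N X act \<rho>\<^sub>g .
  show "\<exists>!\<rho>. extended_coaction act \<rho>\<^sub>g \<rho>"
    using extended_coaction extended_coaction_unique by (rule ex1I)
  show "matched_pair \<Delta> \<epsilon> S uea_comul uea_counit uea_antipode
          (uea_action act) (uea_coaction act \<rho>\<^sub>g)"
    using matched_pair_uea by (simp only: uea_coaction_eq)
next
  fix act :: "'g uea \<Rightarrow> 'f \<Rightarrow> 'f" and \<rho>
  assume "matched_pair \<Delta> \<epsilon> S
    (uea_comul :: 'g uea \<Rightarrow> 'g uea \<otimes> 'g uea) uea_counit uea_antipode act \<rho>"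
  then interpret uea_matched_pair N X \<Delta> \<epsilon> S act \<rho>
    by (intro uea_matched_pair.intro finite_lie_basis.intro assms)
  show "\<exists>\<rho>\<^sub>g. restricts_to \<rho> \<rho>\<^sub>g \<and> g_hopf_algebra \<Delta> \<epsilon> S N X (\<lambda>x f. act (\<iota> x) f) \<rho>\<^sub>g"
    using restricts_to_coact g_hopf_algebra_restriction by blast
qed

end
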